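(* Let $X$ be a path-connected, locally path-connected metric space, $x_0\in X$, and let $F_S$ be the free group on a finite set $S$, acting on $X$ by homeomorphisms. For every $s\in S$ choose a continuous path $\alpha_s$ from $x_0$ to $s\cdot x_0$. Then this choice of paths induces an isomorphism of groups $$\Phi_S\colon\pi_1(X,x_0)\rtimes_{\phi_S}F_S\longrightarrow J_S\Pi_1(X,x_0),\qquad ([\gamma],w)\longmapsto\Bigl[\gamma\,\alpha_w\stackrel{\vec s_1^{\,-1}}{\rightsquigarrow}\stackrel{\vec s_2^{\,-1}}{\rightsquigarrow}\cdots\stackrel{\vec s_n^{\,-1}}{\rightsquigarrow}x_0\Bigr],$$ where $w=\vec s_1\vec s_2\cdots\vec s_n$ with $\vec s_i\in S\cup S^{-1}$.
   Context: Jumping-paths. A jumping-path $\gamma_0\stackrel{\vec s_1}{\rightsquigarrow}\gamma_1\stackrel{\vec s_2}{\rightsquigarrow}\cdots\stackrel{\vec s_n}{\rightsquigarrow}\gamma_n$ in $X$ is a finite sequence of continuous paths $\gamma_0,\dots,\gamma_n\colon[0,1]\to X$ and elements $\vec s_1,\dots,\vec s_n\in S\cup S^{-1}$ with $\gamma_i(0)=\vec s_i\cdot\gamma_{i-1}(1)$ for $i=1,\dots,n$. Its jumping pattern is $(\vec s_1,\dots,\vec s_n)$. Constant internal paths are omitted from the notation, and a constant initial or terminal path is denoted by its value. Jumping-paths are concatenated in the obvious way (the last continuous piece of the first being concatenated with the first continuous piece of the second). Homotopy. Two jumping-paths with the same pattern, with pieces $\gamma_i$ and $\gamma_i'$, are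 spatially-homotopic if there are free homotopies $H_i$ from $\gamma_i=H_i(\cdot,0)$ to $\gamma_i'=H_i(\cdot,1)$ such that for all $t\in[0,1]$: $H_0(0,t)=\gamma_0(0)=\gamma_0'(0)$, $H_n(1,t)=\gamma_n(1)=\gamma_n'(1)$, and $H_i(0,t)=\vec s_i\cdot H_{i-1}(1,t)$ for $i=1,\dots,n$. If a jumping-path has two consecutive opposite jumps, $\vec{\gamma}_1\stackrel{\vec s}{\rightsquigarrow}\stackrel{\vec s^{\,-1}}{\rightsquigarrow}\vec{\gamma}_2$ (with constant path between the two jumps), then $\vec\gamma_1\vec\gamma_2$ is a contraction of it; the inverse operation is an extension. Two jumping-paths are homotopic if one can be transformed into the other by finitely many spatial homotopies, contractions and extensions. The jumping-fundamental group $J_S\Pi_1(X,x_0)$ is the group of homotopy classes of closed jumping-paths based at $x_0$, with concatenation. Paths $\alpha_w$ and $\phi_S$. For a path $\gamma$, $\gamma^*$ is the reversed path. Put $\alpha_{s^{-1}}=s^{-1}(\alpha_s^* )$ and, for $w=\vec s_1\cdots\vec s_n$, $\alpha_w=\alpha_{\vec s_1}\,\vec s_1(\alpha_{\vec s_2})\cdots(\vec s_1\cdots\vec s_{n-1})(\alpha_{\vec s_n})$. The homomorphism $\phi_S\colon F_S\to\mathrm{Aut}(\pi_1(X,x_0))$ is given by $\phi_S(w)[\gamma]=[\alpha_w\,w(\gamma)\,\alpha_w^*]$. *)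

theory Defs
  imports "HOL-Analysis.Analysis" "HOL-Algebra.Group_Action"
begin

section \<open>Free groups as groups of reduced words\<close>

text \<open>The letter \<open>(s, True)\<close> stands for the generator \<open>s\<close> and \<open>(s, False)\<close> for \<open>s\<inverse>\<close>, so
  \<open>S \<union> S\<inverse>\<close> is represented by \<open>S \<times> UNIV\<close>. Elements of the free group are the reduced words;
  \<open>reduce w\<close> is the element represented by an arbitrary word \<open>w\<close>.\<close>

type_synonym 's letter = "'s \<times> bool"

definition inv_letter :: "'s letter \<Rightarrow> 's letter" where
  "inv_letter l = (fst l, \<not> snd l)"

definition words :: "'s set \<Rightarrow> 's letter list set" where
  "words S = lists (S \<times> UNIV)"

definition reduced :: "'s letter list \<Rightarrow> bool" where
  "reduced w \<longleftrightarrow> successively (\<lambda>l m. m \<noteq> inv_letter l) w"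

fun cancel_cons :: "'s letter \<Rightarrow> 's letter list \<Rightarrow> 's letter list" where
  "cancel_cons l [] = [l]"
| "cancel_cons l (m # w) = (if m = inv_letter l then w else l # m # w)"

definition reduce :: "'s letter list \<Rightarrow> 's letter list" where
  "reduce w = foldr cancel_cons w []"

definition free_group :: "'s set \<Rightarrow> 's letter list monoid" where
  "free_group S =
    \<lparr>carrier = {w \<in> words S. reduced w}, mult = (\<lambda>u v. reduce (u @ v)), one = []\<rparr>"

lemma inv_letter_inv_letter [simp]: "inv_letter (inv_letter l) = l"
  by (simp add: inv_letter_def)

lemma reduced_cancel_cons: "reduced w \<Longrightarrow> reduced (cancel_cons l w)"
  by (cases w) (auto simp: reduced_def successively_Cons)

lemma reduced_foldr_cancel_cons: "reduced w \<Longrightarrow> reduced (foldr cancel_cons u w)"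
  by (induction u) (auto intro: reduced_cancel_cons)

lemma reduced_reduce: "reduced (reduce w)"
  unfolding reduce_def by (rule reduced_foldr_cancel_cons) (simp add: reduced_def)

lemma cancel_cons_inv_letter:
  assumes "reduced w"
  shows "cancel_cons (inv_letter l) (cancel_cons l w) = w"
  using assms
  by (cases w rule: remdups_adj.cases) (auto simp: reduced_def)

lemma foldr_cancel_cons_cancel_cons:
  assumes "reduced w"
  shows "foldr cancel_cons (cancel_cons l u) w = cancel_cons l (foldr cancel_cons u w)"
proof (cases u)
  case (Cons m v)
  then show ?thesis
    using cancel_cons_inv_letter[OF reduced_foldr_cancel_cons[OF assms], of "inv_letter l" v]
    by auto
qed auto

lemma foldr_cancel_cons_reduce:
  "reduced w \<Longrightarrow> foldr cancel_cons (reduce u) w = foldr cancel_cons u w"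
  by (induction u) (auto simp: reduce_def foldr_cancel_cons_cancel_cons)

lemma reduce_append: "reduce (u @ v) = foldr cancel_cons u (reduce v)"
  by (simp add: reduce_def)

lemma reduce_append_reduce: "reduce (reduce u @ v) = reduce (u @ v)"
  "reduce (u @ reduce v) = reduce (u @ v)"
  by (simp_all add: reduce_append foldr_cancel_cons_reduce reduced_reduce)
     (simp add: reduce_def foldr_cancel_cons_reduce[unfolded reduce_def] reduced_def)

lemma reduce_reduced: "reduced w \<Longrightarrow> reduce w = w"
proof (induction w)
  case (Cons l w)
  then have "reduced w" by (cases w) (auto simp: reduced_def)
  then show ?case using Cons by (cases w) (auto simp: reduce_def reduced_def)
qed (simp add: reduce_def)

lemma cancel_cons_words: "w \<in> words S \<Longrightarrow> fst l \<in> S \<Longrightarrow> cancel_cons l w \<in> words S"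
  by (cases w; cases l) (auto simp: words_def)

lemma reduce_words: "w \<in> words S \<Longrightarrow> reduce w \<in> words S"
proof (induction w)
  case (Cons l w)
  then show ?case
    using cancel_cons_words[of "reduce w" S l] by (auto simp: words_def reduce_def)
qed (simp add: reduce_def)

lemma reduce_inverse: "reduce (map inv_letter (rev w) @ w) = []"
proof (induction w)
  case (Cons l w)
  have "reduce (map inv_letter (rev (l # w)) @ l # w) =
      foldr cancel_cons (map inv_letter (rev w))
        (cancel_cons (inv_letter l) (cancel_cons l (reduce w)))"
    by (simp add: reduce_def)
  also have "\<dots> = reduce (map inv_letter (rev w) @ w)"
    by (simp add: cancel_cons_inv_letter reduced_reduce reduce_append)
  finally show ?case using Cons by simp
qed (simp add: reduce_def)

lemma group_free_group: "group (free_group S)"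
proof (rule groupI)
  fix u assume u: "u \<in> carrier (free_group S)"
  have "map inv_letter (rev u) \<in> words S"
    using u by (fastforce simp: free_group_def words_def inv_letter_def)
  then show "\<exists>v\<in>carrier (free_group S). v \<otimes>\<^bsub>free_group S\<^esub> u = \<one>\<^bsub>free_group S\<^esub>"
    using u
    by (intro bexI[of _ "reduce (map inv_letter (rev u))"])
       (auto simp: free_group_def reduced_reduce reduce_words reduce_append_reduce reduce_inverse)
qed (auto simp: free_group_def reduced_reduce reduce_words reduce_append_reduce reduce_reduced
       words_def[of S, symmetric] intro!: reduce_words, auto simp: words_def reduced_def)


section \<open>Semidirect products and the fundamental group\<close>

definition semidirect_prod ::
  "('n, 'c) monoid_scheme \<Rightarrow> ('h, 'd) monoid_scheme \<Rightarrow> ('h \<Rightarrow> 'n \<Rightarrow> 'n) \<Rightarrow> ('n \<times> 'h) monoid" where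
  "semidirect_prod N H \<phi> =
    \<lparr>carrier = carrier N \<times> carrier H,
     mult = (\<lambda>(n, h) (n', h'). (n \<otimes>\<^bsub>N\<^esub> \<phi> h n', h \<otimes>\<^bsub>H\<^esub> h')),
     one = (\<one>\<^bsub>N\<^esub>, \<one>\<^bsub>H\<^esub>)\<rparr>"

definition loops_at :: "'a::topological_space set \<Rightarrow> 'a \<Rightarrow> (real \<Rightarrow> 'a) set" where
  "loops_at X x0 = {p. path p \<and> path_image p \<subseteq> X \<and> pathstart p = x0 \<and> pathfinish p = x0}"

definition path_class :: "'a::topological_space set \<Rightarrow> (real \<Rightarrow> 'a) \<Rightarrow> (real \<Rightarrow> 'a) set" where
  "path_class X p = {q. homotopic_paths X p q}"

definition fundamental_group ::
  "'a::topological_space set \<Rightarrow> 'a \<Rightarrow> (real \<Rightarrow> 'a) set monoid" where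
  "fundamental_group X x0 =
    \<lparr>carrier = path_class X ` loops_at X x0,
     mult = (\<lambda>C D. \<Union>p\<in>C. \<Union>q\<in>D. path_class X (p +++ q)),
     one = path_class X (\<lambda>_. x0)\<rparr>"


section \<open>Jumping-paths\<close>

text \<open>A jumping-path is a pair of its list of continuous pieces \<open>\<gamma>\<^sub>0, \<dots>, \<gamma>\<^sub>n\<close> and its jumping
  pattern \<open>s\<^sub>1, \<dots>, s\<^sub>n\<close>; hence \<open>ss ! i\<close> is the jump from piece \<open>i\<close> to piece \<open>Suc i\<close>. Throughout,
  \<open>act w\<close> is the action on \<open>X\<close> of the element \<open>w\<close> of the free group.\<close>

type_synonym ('s, 'a) jpath = "(real \<Rightarrow> 'a) list \<times> 's letter list"

definition is_jpath ::
  "'s set \<Rightarrow> ('s letter list \<Rightarrow> 'a \<Rightarrow> 'a) \<Rightarrow> 'a::topological_space set \<Rightarrow> ('s, 'a) jpath \<Rightarrow> bool" where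
  "is_jpath S act X J \<longleftrightarrow>
    (case J of (ps, ss) \<Rightarrow>
      length ps = Suc (length ss) \<and>
      (\<forall>p\<in>set ps. path p \<and> path_image p \<subseteq> X) \<and>
      ss \<in> words S \<and>
      (\<forall>i<length ss. pathstart (ps ! Suc i) = act [ss ! i] (pathfinish (ps ! i))))"

definition jstart :: "('s, 'a::topological_space) jpath \<Rightarrow> 'a" where
  "jstart J = pathstart (hd (fst J))"

definition jfinish :: "('s, 'a::topological_space) jpath \<Rightarrow> 'a" where
  "jfinish J = pathfinish (last (fst J))"

definition jconcat ::
  "('s, 'a::topological_space) jpath \<Rightarrow> ('s, 'a) jpath \<Rightarrow> ('s, 'a) jpath" where
  "jconcat J K =
    (butlast (fst J) @ [last (fst J) +++ hd (fst K)] @ tl (fst K), snd J @ snd K)"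

text \<open>In \<open>H i (u, t)\<close>, the first coordinate is the path parameter and the second one the
  parameter of the homotopy.\<close>

definition spatially_homotopic ::
  "'s set \<Rightarrow> ('s letter list \<Rightarrow> 'a \<Rightarrow> 'a) \<Rightarrow> 'a::topological_space set \<Rightarrow>
    ('s, 'a) jpath \<Rightarrow> ('s, 'a) jpath \<Rightarrow> bool" where
  "spatially_homotopic S act X J K \<longleftrightarrow>
    is_jpath S act X J \<and> is_jpath S act X K \<and> snd J = snd K \<and>
    (let ps = fst J; qs = fst K; ss = snd J; n = length ss in
      \<exists>H :: nat \<Rightarrow> real \<times> real \<Rightarrow> 'a.
        (\<forall>i\<le>n. continuous_on ({0..1} \<times> {0..1}) (H i) \<and> H i ` ({0..1} \<times> {0..1}) \<subseteq> X \<and>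
          (\<forall>u\<in>{0..1}. H i (u, 0) = (ps ! i) u \<and> H i (u, 1) = (qs ! i) u)) \<and>
        (\<forall>t\<in>{0..1}.
          H 0 (0, t) = (ps ! 0) 0 \<and> H 0 (0, t) = (qs ! 0) 0 \<and>
          H n (1, t) = (ps ! n) 1 \<and> H n (1, t) = (qs ! n) 1 \<and>
          (\<forall>i<n. H (Suc i) (0, t) = act [ss ! i] (H i (1, t)))))"

definition contracts ::
  "'s set \<Rightarrow> ('s letter list \<Rightarrow> 'a \<Rightarrow> 'a) \<Rightarrow> 'a::topological_space set \<Rightarrow>
    ('s, 'a) jpath \<Rightarrow> ('s, 'a) jpath \<Rightarrow> bool" where
  "contracts S act X J K \<longleftrightarrow>
    is_jpath S act X J \<and>
    (\<exists>ps ss qs ts c l.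
      length ps = Suc (length ss) \<and> length qs = Suc (length ts) \<and>
      (\<forall>t\<in>{0..1}. c t = c 0) \<and>
      J = (ps @ [c] @ qs, ss @ [l, inv_letter l] @ ts) \<and>
      K = jconcat (ps, ss) (qs, ts))"

definition jhomotopic ::
  "'s set \<Rightarrow> ('s letter list \<Rightarrow> 'a \<Rightarrow> 'a) \<Rightarrow> 'a::topological_space set \<Rightarrow>
    ('s, 'a) jpath \<Rightarrow> ('s, 'a) jpath \<Rightarrow> bool" where
  "jhomotopic S act X =
    (\<lambda>J K. spatially_homotopic S act X J K \<or> contracts S act X J K \<or> contracts S act X K J)\<^sup>*\<^sup>*"

definition jclass ::
  "'s set \<Rightarrow> ('s letter list \<Rightarrow> 'a \<Rightarrow> 'a) \<Rightarrow> 'a::topological_space set \<Rightarrow>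
    ('s, 'a) jpath \<Rightarrow> ('s, 'a) jpath set" where
  "jclass S act X J = {K. jhomotopic S act X J K}"

definition jloops_at ::
  "'s set \<Rightarrow> ('s letter list \<Rightarrow> 'a \<Rightarrow> 'a) \<Rightarrow> 'a::topological_space set \<Rightarrow> 'a \<Rightarrow>
    ('s, 'a) jpath set" where
  "jloops_at S act X x0 = {J. is_jpath S act X J \<and> jstart J = x0 \<and> jfinish J = x0}"

definition jumping_fundamental_group ::
  "'s set \<Rightarrow> ('s letter list \<Rightarrow> 'a \<Rightarrow> 'a) \<Rightarrow> 'a::topological_space set \<Rightarrow> 'a \<Rightarrow>
    ('s, 'a) jpath set monoid" where
  "jumping_fundamental_group S act X x0 =
    \<lparr>carrier = jclass S act X ` jloops_at S act X x0,
     mult = (\<lambda>C D. \<Union>J\<in>C. \<Union>K\<in>D. jclass S act X (jconcat J K)),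
     one = jclass S act X ([\<lambda>_. x0], [])\<rparr>"


section \<open>The paths \<open>\<alpha>\<^sub>w\<close>, the action \<open>\<phi>\<^sub>S\<close> and the representatives of \<open>\<Phi>\<^sub>S\<close>\<close>

text \<open>Concatenation of a list of paths, bracketed to the right; the empty concatenation is the
  constant path at \<open>x\<close>. Only homotopy classes matter, so the bracketing is immaterial.\<close>

fun path_concat :: "'a::topological_space \<Rightarrow> (real \<Rightarrow> 'a) list \<Rightarrow> real \<Rightarrow> 'a" where
  "path_concat x [] = (\<lambda>_. x)"
| "path_concat x [p] = p"
| "path_concat x (p # q # ps) = p +++ path_concat x (q # ps)"

definition alpha_letter ::
  "('s letter list \<Rightarrow> 'a \<Rightarrow> 'a) \<Rightarrow> ('s \<Rightarrow> real \<Rightarrow> 'a::topological_space) \<Rightarrow>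
    's letter \<Rightarrow> real \<Rightarrow> 'a" where
  "alpha_letter act \<alpha> l =
    (if snd l then \<alpha> (fst l) else act [l] \<circ> reversepath (\<alpha> (fst l)))"

definition alpha_word ::
  "('s letter list \<Rightarrow> 'a \<Rightarrow> 'a) \<Rightarrow> 'a \<Rightarrow> ('s \<Rightarrow> real \<Rightarrow> 'a::topological_space) \<Rightarrow>
    's letter list \<Rightarrow> real \<Rightarrow> 'a" where
  "alpha_word act x0 \<alpha> w =
    path_concat x0
      (map (\<lambda>i. act (reduce (take i w)) \<circ> alpha_letter act \<alpha> (w ! i)) [0..<length w])"

definition phi ::
  "('s letter list \<Rightarrow> 'a \<Rightarrow> 'a) \<Rightarrow> 'a::topological_space set \<Rightarrow> 'a \<Rightarrow> ('s \<Rightarrow> real \<Rightarrow> 'a) \<Rightarrow>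
    's letter list \<Rightarrow> (real \<Rightarrow> 'a) set \<Rightarrow> (real \<Rightarrow> 'a) set" where
  "phi act X x0 \<alpha> w =
    (\<lambda>C\<in>carrier (fundamental_group X x0).
      \<Union>p\<in>C. path_class X
        (alpha_word act x0 \<alpha> w +++ (act w \<circ> p) +++ reversepath (alpha_word act x0 \<alpha> w)))"

text \<open>After the first \<open>i\<close> jumps \<open>s\<^sub>1\<inverse>, \<dots>, s\<^sub>i\<inverse>\<close> the point \<open>w \<cdot> x\<^sub>0\<close> has moved to
  \<open>(s\<^sub>i\<^sub>+\<^sub>1 \<cdots> s\<^sub>n) \<cdot> x\<^sub>0\<close>, which is where the \<open>i\<close>-th (constant) piece sits.\<close>

definition Phi_rep ::
  "('s letter list \<Rightarrow> 'a \<Rightarrow> 'a) \<Rightarrow> 'a::topological_space \<Rightarrow> ('s \<Rightarrow> real \<Rightarrow> 'a) \<Rightarrow>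
    (real \<Rightarrow> 'a) \<Rightarrow> 's letter list \<Rightarrow> ('s, 'a) jpath" where
  "Phi_rep act x0 \<alpha> p w =
    ((p +++ alpha_word act x0 \<alpha> w) #
       map (\<lambda>i. \<lambda>_. act (reduce (drop i w)) x0) [1..<Suc (length w)],
     map inv_letter w)"

end

theory Submission
  imports Defs
begin

text \<open>A jumping-path \<open>\<gamma>\<^sub>0, \<dots>, \<gamma>\<^sub>n\<close> with pattern \<open>s\<^sub>1, \<dots>, s\<^sub>n\<close> unfolds to the honest path
  \<open>\<gamma>\<^sub>0 \<cdot> s\<^sub>1\<inverse>(\<gamma>\<^sub>1) \<cdot> (s\<^sub>1\<inverse> s\<^sub>2\<inverse>)(\<gamma>\<^sub>2) \<cdots>\<close> in \<open>X\<close>. The homotopy class of the unfolding and the reduced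
  pattern are a complete invariant of jumping-paths up to homotopy: both are unchanged by spatial
  homotopies and contractions, and conversely every jumping-path can be slid, jump by jump, into its
  unfolding followed by jumps between constant paths, where the pattern can be freely reduced.
  A closed jumping-path is thus the same as an element \<open>w\<close> of the free group (the inverses of the
  jumps, multiplied in order) with a homotopy class of paths from \<open>x\<^sub>0\<close> to \<open>w \<cdot> x\<^sub>0\<close>; composing with the
  inverse of \<open>\<alpha>\<^sub>w\<close> turns the latter into an element of the fundamental group. Concatenation unfolds
  the second factor through \<open>w\<close>, which gives the semidirect product.\<close>

text \<open>A spatial homotopy fixes only the two outer ends; the inner ends move, coupled by the
  jumps. Translating the pieces back through the jumps makes coupled ends coincide, so that the free
  homotopies paste to one homotopy with fixed ends. The same freedom of the inner ends is what
  permits sliding. Every identity between jumping-paths thus becomes one between reduced words and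
  one in the fundamental groupoid of \<open>X\<close>, on which the free group acts. There the paths
  along words satisfy the cocycle rule alpha_(uv) = alpha_u u(alpha_v), and alpha on inverse letters
  is chosen such that the rule survives free cancellation; from it come the multiplicativity of
  \<open>phi\<close> in the word and that of the isomorphism. Associativity and inverses in the
  jumping-fundamental group are inherited through the isomorphism.\<close>

section \<open>Words and free reduction\<close>

lemma words_simps [simp]:
  "[] \<in> words S"
  "l # w \<in> words S \<longleftrightarrow> fst l \<in> S \<and> w \<in> words S"
  "u @ w \<in> words S \<longleftrightarrow> u \<in> words S \<and> w \<in> words S"
  "map inv_letter w \<in> words S \<longleftrightarrow> w \<in> words S"
  by (cases l; force simp: words_def inv_letter_def in_lists_conv_set)+

lemma fst_inv_letter [simp]: "fst (inv_letter l) = fst l"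
  by (simp add: inv_letter_def)

lemma inv_letter_comp_inv_letter [simp]: "inv_letter \<circ> inv_letter = id"
  by (simp add: fun_eq_iff)

lemma reduce_Nil [simp]: "reduce [] = []"
  by (simp add: reduce_def)

lemma reduce_Cons: "reduce (l # w) = cancel_cons l (reduce w)"
  by (simp add: reduce_def)

lemma reduce_reduce [simp]: "reduce (reduce w) = reduce w"
  by (simp add: reduce_reduced reduced_reduce)

lemma reduce_singleton [simp]: "reduce [l] = [l]"
  by (simp add: reduce_def)

lemma cancel_cons_map_inv_letter:
  "cancel_cons (inv_letter l) (map inv_letter w) = map inv_letter (cancel_cons l w)"
  by (cases w) (auto simp: inv_letter_def)

text \<open>Inverting every letter and keeping the order extends the inversion of generators to an
  automorphism of the free group. It is needed because the pattern belonging to \<open>w\<close> is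
  \<open>map inv_letter w\<close>, not the inverse word.\<close>

lemma reduce_map_inv_letter: "reduce (map inv_letter w) = map inv_letter (reduce w)"
  by (induction w) (simp_all add: reduce_Cons cancel_cons_map_inv_letter)

lemma reduce_append_cong:
  "reduce u = reduce u' \<Longrightarrow> reduce v = reduce v' \<Longrightarrow> reduce (u @ v) = reduce (u' @ v')"
  by (metis reduce_append_reduce)

lemma free_group_carrier: "w \<in> carrier (free_group S) \<longleftrightarrow> w \<in> words S \<and> reduced w"
  by (simp add: free_group_def)

lemma reduce_in_free_group: "w \<in> words S \<Longrightarrow> reduce w \<in> carrier (free_group S)"
  by (simp add: free_group_carrier reduce_words reduced_reduce)


section \<open>Homotopy classes of paths\<close>

definition path_in :: "'a::topological_space set \<Rightarrow> (real \<Rightarrow> 'a) \<Rightarrow> bool" where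
  "path_in X p \<longleftrightarrow> path p \<and> path_image p \<subseteq> X"

text \<open>An equivalence and not an implication, since joins that do not fit must be recognised as
  non-paths. For this direction limits have to be unique: a continuous join takes both end values at
  its middle.\<close>

lemma path_in_join [simp]:
  fixes p q :: "real \<Rightarrow> 'a::metric_space"
  assumes "path_in X p" "path_in X q"
  shows "path_in X (p +++ q) \<longleftrightarrow> pathfinish p = pathstart q"
  using assms by (auto simp: path_in_def path_join_eq subset_path_image_join)

lemma path_in_reversepath [simp]: "path_in X (reversepath p) \<longleftrightarrow> path_in X p"
  by (simp add: path_in_def)

lemma homotopic_paths_refl_path_in: "homotopic_paths X p p \<longleftrightarrow> path_in X p"
  by (simp add: path_in_def)

lemma path_in_const [simp]: "path_in X (\<lambda>_. x) \<longleftrightarrow> x \<in> X"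
  by (auto simp: path_in_def path_image_def path_def)

lemma pathstart_const [simp]: "pathstart (\<lambda>_. x) = x"
  and pathfinish_const [simp]: "pathfinish (\<lambda>_. x) = x"
  by (simp_all add: pathstart_def pathfinish_def)

lemma path_in_pathstart: "path_in X p \<Longrightarrow> pathstart p \<in> X"
  and path_in_pathfinish: "path_in X p \<Longrightarrow> pathfinish p \<in> X"
  by (auto simp: path_in_def)

lemma path_in_value: "path_in X p \<Longrightarrow> 0 \<le> t \<Longrightarrow> t \<le> 1 \<Longrightarrow> p t \<in> X"
  by (auto simp: path_in_def path_image_def)

lemma path_class_eq_iff: "path_in X p \<Longrightarrow> path_class X p = path_class X q \<longleftrightarrow> homotopic_paths X p q"
  unfolding path_class_def path_in_def
  by (metis (no_types, lifting) Collect_cong homotopic_paths_refl homotopic_paths_sym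
      homotopic_paths_trans mem_Collect_eq)

lemma path_class_eqI: "homotopic_paths X p q \<Longrightarrow> path_class X p = path_class X q"
  using path_class_eq_iff homotopic_paths_imp_path homotopic_paths_imp_subset path_in_def by metis

lemma path_class_cong:
  assumes "path_in X p" "\<And>t. t \<in> {0..1} \<Longrightarrow> p t = q t"
  shows "path_class X p = path_class X q"
  using assms by (intro path_class_eqI homotopic_paths_eq) (auto simp: path_in_def)

text \<open>\<open>homotopic_paths\<close> relates only paths inside \<open>X\<close>. The empty
  class of everything else is the default value on which the total product below relies.\<close>

lemma path_class_eq_empty: "path_class X p = {} \<longleftrightarrow> \<not> path_in X p"
  unfolding path_class_def path_in_def
  by (metis (no_types, lifting) empty_Collect_eq homotopic_paths_imp_path homotopic_paths_imp_subset
      homotopic_paths_refl)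

lemma in_path_class: "q \<in> path_class X p \<longleftrightarrow> homotopic_paths X p q"
  by (simp add: path_class_def)

lemma path_in_path_class: "q \<in> path_class X p \<Longrightarrow> path_in X q"
  by (metis in_path_class homotopic_paths_imp_path homotopic_paths_imp_subset path_in_def)

lemma in_path_class_self: "path_in X p \<Longrightarrow> p \<in> path_class X p"
  by (simp add: in_path_class path_in_def)

text \<open>The product is total: classes of non-composable paths multiply to the empty set, and the empty set
  is absorbing. So associativity needs no side conditions.\<close>

definition class_prod ::
  "'a::topological_space set \<Rightarrow> (real \<Rightarrow> 'a) set \<Rightarrow> (real \<Rightarrow> 'a) set \<Rightarrow> (real \<Rightarrow> 'a) set" where
  "class_prod X C D = (\<Union>p\<in>Collect (path_in X) \<inter> C. \<Union>q\<in>Collect (path_in X) \<inter> D. path_class X (p +++ q))"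

lemma in_class_prod:
  "r \<in> class_prod X C D \<longleftrightarrow>
    (\<exists>p\<in>C. \<exists>q\<in>D. path_in X p \<and> path_in X q \<and> homotopic_paths X (p +++ q) r)"
  by (auto simp: class_prod_def in_path_class)

lemma in_class_prodI:
  "p \<in> C \<Longrightarrow> q \<in> D \<Longrightarrow> path_in X p \<Longrightarrow> path_in X q \<Longrightarrow> homotopic_paths X (p +++ q) r \<Longrightarrow>
    r \<in> class_prod X C D"
  unfolding in_class_prod by blast

text \<open>For paths that fit, this is the compatibility of homotopy with joining; otherwise both
  sides are empty. Without an endpoint condition it can serve as a rewrite rule from joins to
  products.\<close>

lemma class_prod_path_class:
  fixes p q :: "real \<Rightarrow> 'a::metric_space"
  assumes "path_in X p" "path_in X q"
  shows "path_class X (p +++ q) = class_prod X (path_class X p) (path_class X q)"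
proof -
  have "path_class X (p' +++ q') = path_class X (p +++ q)"
    if "homotopic_paths X p p'" "homotopic_paths X q q'" for p' q'
  proof (cases "pathfinish p = pathstart q")
    case True
    then show ?thesis
      using homotopic_paths_join[OF that] path_class_eqI by metis
  next
    case False
    have "path_in X p'" "path_in X q'"
      using that path_in_path_class in_path_class by metis+
    moreover have "pathfinish p' \<noteq> pathstart q'"
      using False that homotopic_paths_imp_pathfinish homotopic_paths_imp_pathstart by metis
    ultimately show ?thesis
      using path_class_eq_empty path_in_join assms False by metis
  qed
  then have "class_prod X (path_class X p) (path_class X q) =
      (\<Union>p'\<in>Collect (path_in X) \<inter> path_class X p. \<Union>q'\<in>Collect (path_in X) \<inter> path_class X q.
        path_class X (p +++ q))"
    unfolding class_prod_def by (intro SUP_cong refl) (auto simp: in_path_class)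
  also have "\<dots> = path_class X (p +++ q)"
    using in_path_class_self[OF assms(1)] in_path_class_self[OF assms(2)] assms by auto
  finally show ?thesis ..
qed

lemma class_prod_assoc:
  fixes C D E :: "(real \<Rightarrow> 'a::metric_space) set"
  shows "class_prod X (class_prod X C D) E = class_prod X C (class_prod X D E)"
proof (intro subset_antisym subsetI)
  fix s assume "s \<in> class_prod X (class_prod X C D) E"
  then obtain p q r t where *: "p \<in> C" "q \<in> D" "r \<in> E" "path_in X p" "path_in X q" "path_in X r"
      "homotopic_paths X (p +++ q) t" "homotopic_paths X (t +++ r) s"
    by (auto simp: in_class_prod)
  \<comment> \<open>The endpoint conditions are recovered from the element \<open>s\<close>: a class
    with a member is the class of a true path, so all joins involved must fit.\<close>
  have t: "path_in X (p +++ q)" "path_in X t" "path_in X (t +++ r)"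
    using * path_in_path_class in_path_class homotopic_paths_sym by metis+
  have e: "pathfinish p = pathstart q" "pathfinish q = pathstart r"
    using t * path_in_join homotopic_paths_imp_pathfinish pathfinish_join by metis+
  have "homotopic_paths X (p +++ (q +++ r)) ((p +++ q) +++ r)"
    using * e by (intro homotopic_paths_assoc) (auto simp: path_in_def)
  also have "homotopic_paths X \<dots> (t +++ r)"
    using * e by (intro homotopic_paths_join) (auto simp: path_in_def)
  also have "homotopic_paths X \<dots> s" by fact
  finally show "s \<in> class_prod X C (class_prod X D E)"
    using * e by (intro in_class_prodI[of p _ "q +++ r"] in_class_prodI[of q _ r])
      (simp_all add: homotopic_paths_refl_path_in del: homotopic_paths_refl)
next
  fix s assume "s \<in> class_prod X C (class_prod X D E)"
  then obtain p q r t where *: "p \<in> C" "q \<in> D" "r \<in> E" "path_in X p" "path_in X q" "path_in X r"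
      "homotopic_paths X (q +++ r) t" "homotopic_paths X (p +++ t) s"
    by (auto simp: in_class_prod)
  have t: "path_in X (q +++ r)" "path_in X t" "path_in X (p +++ t)"
    using * path_in_path_class in_path_class homotopic_paths_sym by metis+
  have e: "pathfinish p = pathstart q" "pathfinish q = pathstart r"
    using t * path_in_join homotopic_paths_imp_pathstart pathstart_join by metis+
  have "homotopic_paths X ((p +++ q) +++ r) (p +++ (q +++ r))"
    using * e by (intro homotopic_paths_sym[OF homotopic_paths_assoc]) (auto simp: path_in_def)
  also have "homotopic_paths X \<dots> (p +++ t)"
    using * e by (intro homotopic_paths_join) (auto simp: path_in_def)
  also have "homotopic_paths X \<dots> s" by fact
  finally show "s \<in> class_prod X (class_prod X C D) E"
    using * e by (intro in_class_prodI[of "p +++ q" _ r] in_class_prodI[of p _ q])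
      (simp_all add: homotopic_paths_refl_path_in del: homotopic_paths_refl)
qed

text \<open>The library states the following three homotopies for normed spaces only.\<close>

lemma homotopic_paths_const_right:
  assumes "path_in X p"
  shows "homotopic_paths X (p +++ (\<lambda>_. pathfinish p)) p"
proof (rule homotopic_paths_sym, rule homotopic_paths_reparametrize[where f = "\<lambda>t. min (2 * t) 1"])
  show "continuous_on {0..1} (\<lambda>t::real. min (2 * t) 1)" by (intro continuous_intros)
qed (use assms in \<open>auto simp: path_in_def joinpaths_def pathfinish_def min_def\<close>)

lemma homotopic_paths_const_left:
  assumes "path_in X p"
  shows "homotopic_paths X ((\<lambda>_. pathstart p) +++ p) p"
proof (rule homotopic_paths_sym, rule homotopic_paths_reparametrize[where f = "\<lambda>t. max (2 * t - 1) 0"])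
  show "continuous_on {0..1} (\<lambda>t::real. max (2 * t - 1) 0)" by (intro continuous_intros)
qed (use assms in \<open>auto simp: path_in_def joinpaths_def pathstart_def max_def\<close>)

lemma homotopic_paths_reversepath_right:
  assumes "path_in X p"
  shows "homotopic_paths X (p +++ reversepath p) (\<lambda>_. pathstart p)"
proof -
  \<comment> \<open>A tent in the path parameter with peak 1 at 1/2, scaled by one minus the time:
    at time s the loop follows \<open>p\<close> up to parameter 1 - s and returns the same
    way.\<close>
  define f :: "real \<times> real \<Rightarrow> real"
    where "f = (\<lambda>y. (1 - fst y) * min (2 * snd y) (2 - 2 * snd y))"
  have f: "f y \<in> {0..1}" if "y \<in> {0..1} \<times> {0..1}" for y
  proof -
    have "0 \<le> min (2 * snd y) (2 - 2 * snd y)" "min (2 * snd y) (2 - 2 * snd y) \<le> 1"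
      using that by auto
    then show ?thesis
      using that by (auto simp: f_def mem_Times_iff intro!: mult_le_one)
  qed
  have p: "continuous_on {0..1} p" "p ` {0..1} \<subseteq> X"
    using assms by (auto simp: path_in_def path_def path_image_def)
  show ?thesis
    unfolding homotopic_paths
  proof (intro exI[of _ "p \<circ> f"] conjI ballI)
    show "continuous_on ({0..1} \<times> {0..1}) (p \<circ> f)"
    proof (rule continuous_on_compose)
      show "continuous_on ({0..1} \<times> {0..1}) f"
        unfolding f_def by (intro continuous_intros)
      show "continuous_on (f ` ({0..1} \<times> {0..1})) p"
        using f by (intro continuous_on_subset[OF p(1)]) blast
    qed
    show "p \<circ> f \<in> {0..1} \<times> {0..1} \<rightarrow> X"
    proof
      fix y :: "real \<times> real" assume "y \<in> {0..1} \<times> {0..1}"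
      then show "(p \<circ> f) y \<in> X"
        using f[of y] p(2) unfolding o_apply by blast
    qed
  qed (auto simp: f_def joinpaths_def reversepath_def pathstart_def pathfinish_def min_def)
qed

context
  fixes X :: "'a::metric_space set" and p :: "real \<Rightarrow> 'a"
  assumes p: "path_in X p"
begin

lemma class_prod_const_left:
  "x = pathstart p \<Longrightarrow> class_prod X (path_class X (\<lambda>_. x)) (path_class X p) = path_class X p"
  using p path_class_eqI[OF homotopic_paths_const_left[OF p]]
  by (simp add: class_prod_path_class path_in_pathstart)

lemma class_prod_const_right:
  "x = pathfinish p \<Longrightarrow> class_prod X (path_class X p) (path_class X (\<lambda>_. x)) = path_class X p"
  using p path_class_eqI[OF homotopic_paths_const_right[OF p]]
  by (simp add: class_prod_path_class path_in_pathfinish)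

lemma class_prod_reversepath_right:
  "class_prod X (path_class X p) (path_class X (reversepath p)) = path_class X (\<lambda>_. pathstart p)"
  using p path_class_eqI[OF homotopic_paths_reversepath_right[OF p]]
  by (simp add: class_prod_path_class)

lemma class_prod_reversepath_left:
  "class_prod X (path_class X (reversepath p)) (path_class X p) = path_class X (\<lambda>_. pathfinish p)"
  using p path_class_eqI[OF homotopic_paths_reversepath_right[of X "reversepath p"]]
  by (simp add: class_prod_path_class)

text \<open>The primed rules cancel at the head of a longer product. Once products are nested to the
  right, the two cancelling factors no longer form a subterm.\<close>

lemma class_prod_const_left':
  "x = pathstart p \<Longrightarrow>
    class_prod X (path_class X (\<lambda>_. x)) (class_prod X (path_class X p) C) = class_prod X (path_class X p) C"
  by (simp add: class_prod_const_left flip: class_prod_assoc)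

lemma class_prod_reversepath_right':
  "class_prod X (path_class X p) (class_prod X (path_class X (reversepath p)) C) =
    class_prod X (path_class X (\<lambda>_. pathstart p)) C"
  by (simp add: class_prod_reversepath_right flip: class_prod_assoc)

lemma class_prod_reversepath_left':
  "class_prod X (path_class X (reversepath p)) (class_prod X (path_class X p) C) =
    class_prod X (path_class X (\<lambda>_. pathfinish p)) C"
  by (simp add: class_prod_reversepath_left flip: class_prod_assoc)

end


section \<open>Unfolding jumping-paths\<close>

locale free_action =
  fixes S :: "'s set" and X :: "'a::metric_space set" and act :: "'s letter list \<Rightarrow> 'a \<Rightarrow> 'a"
  assumes action: "group_action (free_group S) X act"
    and continuous_act: "w \<in> carrier (free_group S) \<Longrightarrow> continuous_on X (act w)"
begin

abbreviation cls :: "(real \<Rightarrow> 'a) \<Rightarrow> (real \<Rightarrow> 'a) set" where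
  "cls \<equiv> path_class X"

abbreviation cprod :: "(real \<Rightarrow> 'a) set \<Rightarrow> (real \<Rightarrow> 'a) set \<Rightarrow> (real \<Rightarrow> 'a) set" (infixr "\<odot>" 70) where
  "C \<odot> D \<equiv> class_prod X C D"

text \<open>The action of an arbitrary word; \<open>act\<close> itself is only constrained on reduced words.\<close>

definition word_act :: "'s letter list \<Rightarrow> 'a \<Rightarrow> 'a" where
  "word_act w = act (reduce w)"

lemma word_act_reduce [simp]: "word_act (reduce w) = word_act w"
  by (simp add: word_act_def)

lemma act_letter: "act [l] = word_act [l]"
  by (simp add: word_act_def)

lemma act_free_group: "w \<in> carrier (free_group S) \<Longrightarrow> act w = word_act w"
  by (simp add: word_act_def free_group_carrier reduce_reduced)

lemma bij_word_act: "w \<in> words S \<Longrightarrow> bij_betw (word_act w) X X"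
  unfolding word_act_def
  using group_action.surj_prop[OF action] group_action.inj_prop[OF action] reduce_in_free_group
  by (metis bij_betw_def)

lemma word_act_in: "w \<in> words S \<Longrightarrow> x \<in> X \<Longrightarrow> word_act w x \<in> X"
  using bij_word_act bij_betwE by metis

lemma word_act_eq_iff:
  "w \<in> words S \<Longrightarrow> x \<in> X \<Longrightarrow> y \<in> X \<Longrightarrow> word_act w x = word_act w y \<longleftrightarrow> x = y"
  using bij_word_act by (meson bij_betw_imp_inj_on inj_on_eq_iff)

lemma continuous_word_act: "w \<in> words S \<Longrightarrow> continuous_on X (word_act w)"
  unfolding word_act_def by (intro continuous_act reduce_in_free_group)

lemma word_act_append:
  assumes "u \<in> words S" "v \<in> words S" "x \<in> X"
  shows "word_act (u @ v) x = word_act u (word_act v x)"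
proof -
  have "reduce (u @ v) = reduce u \<otimes>\<^bsub>free_group S\<^esub> reduce v"
    by (simp add: free_group_def reduce_append_reduce)
  then show ?thesis
    using group_action.composition_rule[OF action assms(3)]
      reduce_in_free_group[OF assms(1)] reduce_in_free_group[OF assms(2)]
    by (simp add: word_act_def)
qed

lemma word_act_Nil [simp]: "x \<in> X \<Longrightarrow> word_act [] x = x"
  using group_action.id_eq_one[OF action] by (simp add: word_act_def free_group_def flip: fun_eq_iff) (metis restrict_apply')

lemma word_act_Cons:
  "fst l \<in> S \<Longrightarrow> v \<in> words S \<Longrightarrow> x \<in> X \<Longrightarrow> word_act (l # v) x = word_act [l] (word_act v x)"
  using word_act_append[of "[l]" v x] by simp

lemma word_act_cong: "reduce u = reduce v \<Longrightarrow> word_act u = word_act v"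
  by (simp add: word_act_def)

lemma word_act_inv_letter [simp]:
  assumes "fst l \<in> S" "x \<in> X"
  shows "word_act [inv_letter l] (word_act [l] x) = x" "word_act [l] (word_act [inv_letter l] x) = x"
proof -
  have "word_act [inv_letter l] (word_act [l] x) = word_act [inv_letter l, l] x"
    "word_act [l] (word_act [inv_letter l] x) = word_act [l, inv_letter l] x"
    using assms by (simp_all add: word_act_append[symmetric])
  moreover have "word_act [inv_letter l, l] = word_act []" "word_act [l, inv_letter l] = word_act []"
    by (intro word_act_cong; simp add: reduce_Cons)+
  ultimately show "word_act [inv_letter l] (word_act [l] x) = x"
    "word_act [l] (word_act [inv_letter l] x) = x"
    using assms by simp_all
qed

section \<open>The action on paths and on homotopy classes\<close>

lemma path_in_act [simp]:
  assumes "w \<in> words S" "path_in X p"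
  shows "path_in X (word_act w \<circ> p)"
  using assms continuous_on_subset[OF continuous_word_act] word_act_in
  by (auto simp: path_in_def path_image_compose intro!: path_continuous_image)

lemma homotopic_paths_act:
  "w \<in> words S \<Longrightarrow> homotopic_paths X p q \<Longrightarrow> homotopic_paths X (word_act w \<circ> p) (word_act w \<circ> q)"
  by (rule homotopic_paths_continuous_image) (auto simp: continuous_word_act word_act_in)

text \<open>Nothing is known about \<open>word_act\<close> outside \<open>X\<close>. The restriction
  to paths in \<open>X\<close> lets the laws for products and for iterated action hold for arbitrary
  sets of paths.\<close>

definition class_act :: "'s letter list \<Rightarrow> (real \<Rightarrow> 'a) set \<Rightarrow> (real \<Rightarrow> 'a) set" (infixr "\<bullet>\<^sub>c" 75) where
  "w \<bullet>\<^sub>c C = (\<Union>p\<in>Collect (path_in X) \<inter> C. cls (word_act w \<circ> p))"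

lemma in_class_act:
  "q \<in> w \<bullet>\<^sub>c C \<longleftrightarrow> (\<exists>p\<in>C. path_in X p \<and> homotopic_paths X (word_act w \<circ> p) q)"
  by (auto simp: class_act_def in_path_class)

lemma class_act_cong: "reduce u = reduce v \<Longrightarrow> u \<bullet>\<^sub>c C = v \<bullet>\<^sub>c C"
  by (simp add: class_act_def word_act_def)

lemma class_act_path_class:
  assumes "w \<in> words S" "path_in X p"
  shows "cls (word_act w \<circ> p) = w \<bullet>\<^sub>c cls p"
proof -
  have "w \<bullet>\<^sub>c cls p = (\<Union>q\<in>Collect (path_in X) \<inter> cls p. cls (word_act w \<circ> p))"
    unfolding class_act_def
    by (intro SUP_cong refl path_class_eqI homotopic_paths_act[OF assms(1)])
       (auto simp: in_path_class homotopic_paths_sym)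
  then show ?thesis
    using in_path_class_self[OF assms(2)] assms by auto
qed

text \<open>The action is injective on \<open>X\<close>, so translated paths fit together only if
  the original ones do. Hence both sides are empty at the same time and no endpoint condition
  arises.\<close>

lemma class_act_prod:
  assumes "w \<in> words S"
  shows "w \<bullet>\<^sub>c (C \<odot> D) = w \<bullet>\<^sub>c C \<odot> w \<bullet>\<^sub>c D"
proof (intro subset_antisym subsetI)
  fix s assume "s \<in> w \<bullet>\<^sub>c (C \<odot> D)"
  then obtain p q t where *: "p \<in> C" "q \<in> D" "path_in X p" "path_in X q"
      "homotopic_paths X (p +++ q) t" "homotopic_paths X (word_act w \<circ> t) s"
    by (auto simp: in_class_prod in_class_act)
  have "homotopic_paths X (word_act w \<circ> (p +++ q)) s"
    using homotopic_paths_act[OF assms *(5)] *(6) by (rule homotopic_paths_trans)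
  then show "s \<in> w \<bullet>\<^sub>c C \<odot> w \<bullet>\<^sub>c D"
    using * assms
    by (intro in_class_prodI[of "word_act w \<circ> p" _ "word_act w \<circ> q"])
       (auto simp: path_compose_join in_class_act homotopic_paths_refl_path_in
          simp del: homotopic_paths_refl)
next
  fix s assume "s \<in> w \<bullet>\<^sub>c C \<odot> w \<bullet>\<^sub>c D"
  then obtain p q p' q' where *: "p \<in> C" "q \<in> D" "path_in X p" "path_in X q"
      "homotopic_paths X (word_act w \<circ> p) p'" "homotopic_paths X (word_act w \<circ> q) q'"
      "path_in X p'" "path_in X q'" "homotopic_paths X (p' +++ q') s"
    by (auto simp: in_class_prod in_class_act)
  have "pathfinish p' = pathstart q'"
    using * path_in_path_class in_path_class homotopic_paths_sym path_in_join by metis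
  then have e: "word_act w (pathfinish p) = word_act w (pathstart q)"
    using *(5,6) homotopic_paths_imp_pathfinish homotopic_paths_imp_pathstart
    by (metis pathfinish_compose pathstart_compose)
  then have e': "pathfinish p = pathstart q"
    using * assms by (simp add: word_act_eq_iff path_in_pathstart path_in_pathfinish)
  have "homotopic_paths X (word_act w \<circ> (p +++ q)) (p' +++ q')"
    unfolding path_compose_join using * e
    by (intro homotopic_paths_join) (auto simp: pathfinish_compose pathstart_compose)
  also have "homotopic_paths X \<dots> s" by fact
  finally show "s \<in> w \<bullet>\<^sub>c (C \<odot> D)"
    using * e' unfolding in_class_act
    by (intro bexI[of _ "p +++ q"]) (auto intro!: in_class_prodI[of p _ q]
          simp: homotopic_paths_refl_path_in simp del: homotopic_paths_refl)
qed

lemma class_act_act: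
  assumes "u \<in> words S" "v \<in> words S"
  shows "u \<bullet>\<^sub>c v \<bullet>\<^sub>c C = (u @ v) \<bullet>\<^sub>c C"
proof -
  have "u \<bullet>\<^sub>c v \<bullet>\<^sub>c C = (\<Union>p\<in>Collect (path_in X) \<inter> C. u \<bullet>\<^sub>c cls (word_act v \<circ> p))"
    by (auto simp: class_act_def)
  also have "\<dots> = (\<Union>p\<in>Collect (path_in X) \<inter> C. cls (word_act (u @ v) \<circ> p))"
    using assms
    by (intro SUP_cong refl)
       (auto simp: class_act_path_class[symmetric] word_act_append path_in_value intro!: path_class_cong)
  finally show ?thesis by (simp add: class_act_def)
qed

lemma class_act_Nil [simp]: "path_in X p \<Longrightarrow> [] \<bullet>\<^sub>c cls p = cls p"
  by (subst class_act_path_class[symmetric]) (auto simp: path_in_value intro!: path_class_cong)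

lemma class_act_const: "w \<in> words S \<Longrightarrow> x \<in> X \<Longrightarrow> w \<bullet>\<^sub>c cls (\<lambda>_. x) = cls (\<lambda>_. word_act w x)"
  by (simp add: class_act_path_class[symmetric] o_def)

section \<open>Unfoldings and their ends\<close>

text \<open>The pieces form a family indexed by numbers instead of a list, so that the slices of a
  spatial homotopy \<open>H i\<close> at a fixed time can be unfolded as they are.\<close>

primrec unfold_path :: "'s letter list \<Rightarrow> (nat \<Rightarrow> real \<Rightarrow> 'a) \<Rightarrow> real \<Rightarrow> 'a" where
  "unfold_path [] P = P 0"
| "unfold_path (l # ss) P = P 0 +++ (word_act [inv_letter l] \<circ> unfold_path ss (\<lambda>i. P (Suc i)))"

definition jchain :: "'s letter list \<Rightarrow> (nat \<Rightarrow> real \<Rightarrow> 'a) \<Rightarrow> bool" where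
  "jchain ss P \<longleftrightarrow> ss \<in> words S \<and> (\<forall>i\<le>length ss. path_in X (P i)) \<and>
    (\<forall>i<length ss. pathstart (P (Suc i)) = word_act [ss ! i] (pathfinish (P i)))"

lemma jchain_Nil [simp]: "jchain [] P \<longleftrightarrow> path_in X (P 0)"
  by (simp add: jchain_def)

lemma jchain_Cons [simp]:
  "jchain (l # ss) P \<longleftrightarrow> fst l \<in> S \<and> path_in X (P 0) \<and>
    pathstart (P (Suc 0)) = word_act [l] (pathfinish (P 0)) \<and> jchain ss (\<lambda>i. P (Suc i))"
  by (auto simp: jchain_def All_less_Suc2 less_Suc_eq_le[symmetric] simp del: less_Suc_eq_le)

lemma is_jpath_iff: "is_jpath S act X (ps, ss) \<longleftrightarrow> length ps = Suc (length ss) \<and> jchain ss ((!) ps)"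
  unfolding is_jpath_def jchain_def path_in_def act_letter
  by (auto simp: all_set_conv_all_nth less_Suc_eq_le)

lemma unfold_path:
  assumes "jchain ss P"
  shows "path_in X (unfold_path ss P) \<and> pathstart (unfold_path ss P) = pathstart (P 0) \<and>
    pathfinish (unfold_path ss P) = word_act (map inv_letter ss) (pathfinish (P (length ss)))"
  using assms
proof (induction ss arbitrary: P)
  case Nil
  then show ?case by (simp add: path_in_pathfinish)
next
  case (Cons l ss)
  note IH = Cons.IH[of "\<lambda>i. P (Suc i)"]
  have "path_in X (P (Suc (length ss)))" "ss \<in> words S"
    using Cons.prems by (auto simp: jchain_def)
  then show ?case
    using Cons.prems IH word_act_Cons[of "inv_letter l" "map inv_letter ss"]
    by (simp add: pathstart_compose pathfinish_compose path_in_pathfinish)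
qed

text \<open>Needed because a spatial homotopy agrees with the given pieces only on the unit
  interval.\<close>

lemma unfold_path_cong:
  assumes "\<And>i u. i \<le> length ss \<Longrightarrow> u \<in> {0..1} \<Longrightarrow> P i u = Q i u" "u \<in> {0..1}"
  shows "unfold_path ss P u = unfold_path ss Q u"
  using assms
proof (induction ss arbitrary: P Q u)
  case (Cons l ss)
  have "unfold_path ss (\<lambda>i. P (Suc i)) v = unfold_path ss (\<lambda>i. Q (Suc i)) v" if "v \<in> {0..1}" for v
    using Cons.prems that by (intro Cons.IH) auto
  then show ?case
    using Cons.prems by (auto simp: joinpaths_def)
qed auto

lemma path_class_unfold_path_Cons:
  assumes "jchain (l # ss) P"
  shows "cls (unfold_path (l # ss) P) =
    cls (P 0) \<odot> [inv_letter l] \<bullet>\<^sub>c cls (unfold_path ss (\<lambda>i. P (Suc i)))"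
  using assms unfold_path[of ss "\<lambda>i. P (Suc i)"]
  by (simp add: class_prod_path_class class_act_path_class)

definition unfold :: "('s, 'a) jpath \<Rightarrow> real \<Rightarrow> 'a" where
  "unfold J = unfold_path (snd J) ((!) (fst J))"

abbreviation jpath :: "('s, 'a) jpath \<Rightarrow> bool" where
  "jpath \<equiv> is_jpath S act X"

lemma jpath_Nil: "jpath (ps, []) \<longleftrightarrow> (\<exists>p. ps = [p] \<and> path_in X p)"
  by (auto simp: is_jpath_iff length_Suc_conv)

lemma jpath_Cons:
  "jpath (p # ps, l # ss) \<longleftrightarrow> fst l \<in> S \<and> path_in X p \<and> ps \<noteq> [] \<and>
    pathstart (hd ps) = word_act [l] (pathfinish p) \<and> jpath (ps, ss)"
  by (cases ps) (auto simp: is_jpath_iff)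

lemma jpath_words: "jpath J \<Longrightarrow> snd J \<in> words S"
  by (auto simp: is_jpath_def split: prod.splits)

lemma jpath_nonempty: "jpath (ps, ss) \<Longrightarrow> ps \<noteq> []"
  by (auto simp: is_jpath_iff)

text \<open>Dropping the first piece together with the first jump changes the start point. The
  invariants are therefore developed for all jumping-paths and not only for closed ones.\<close>

lemma jpath_induct [consumes 1, case_names Nil Cons]:
  assumes "jpath (ps, ss)"
    and "\<And>p. path_in X p \<Longrightarrow> Q [p] []"
    and "\<And>p ps l ss. fst l \<in> S \<Longrightarrow> path_in X p \<Longrightarrow> ps \<noteq> [] \<Longrightarrow>
      pathstart (hd ps) = word_act [l] (pathfinish p) \<Longrightarrow> jpath (ps, ss) \<Longrightarrow> Q ps ss \<Longrightarrow>
      Q (p # ps) (l # ss)"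
  shows "Q ps ss"
  using assms(1)
proof (induction ss arbitrary: ps)
  case Nil
  then show ?case using assms(2) by (auto simp: jpath_Nil)
next
  case (Cons l ss)
  then obtain p qs where "ps = p # qs" by (cases ps) (auto simp: is_jpath_iff)
  with Cons show ?case using assms(3)[of l p qs ss] by (auto simp: jpath_Cons)
qed

lemma unfold_ends:
  assumes "jpath J"
  shows "path_in X (unfold J)" "pathstart (unfold J) = jstart J"
    "pathfinish (unfold J) = word_act (map inv_letter (snd J)) (jfinish J)"
proof -
  obtain ps ss where J: "J = (ps, ss)" by fastforce
  have "jchain ss ((!) ps)" "length ps = Suc (length ss)"
    using assms by (auto simp: J is_jpath_iff)
  then show "path_in X (unfold J)" "pathstart (unfold J) = jstart J"
    "pathfinish (unfold J) = word_act (map inv_letter (snd J)) (jfinish J)"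
    using unfold_path[of ss "(!) ps"] hd_conv_nth[of ps] last_conv_nth[of ps]
    by (force simp: J unfold_def jstart_def jfinish_def)+
qed

lemma jfinish_in:
  assumes "jpath J"
  shows "jfinish J \<in> X"
proof -
  have "last (fst J) \<in> set (fst J)" "\<forall>p\<in>set (fst J). path_in X p"
    using assms by (auto simp: is_jpath_def path_in_def split: prod.splits intro!: last_in_set)
  then show ?thesis
    unfolding jfinish_def using path_in_pathfinish by blast
qed

section \<open>Unfoldings of concatenations and contractions\<close>

lemma class_unfold_Nil [simp]: "cls (unfold ([p], [])) = cls p"
  by (simp add: unfold_def)

lemma class_unfold_Cons:
  "jpath (p # ps, l # ss) \<Longrightarrow>
    cls (unfold (p # ps, l # ss)) = cls p \<odot> [inv_letter l] \<bullet>\<^sub>c cls (unfold (ps, ss))"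
  unfolding unfold_def
  using path_class_unfold_path_Cons[of l ss "(!) (p # ps)"] by (simp add: is_jpath_iff)

lemma jconcat_single: "jconcat ([p], ss) (q # qs, ts) = ((p +++ q) # qs, ss @ ts)"
  by (simp add: jconcat_def)

lemma jconcat_Cons:
  "ps \<noteq> [] \<Longrightarrow> jconcat (p # ps, l # ss) K =
    (p # fst (jconcat (ps, ss) K), l # snd (jconcat (ps, ss) K))"
  by (simp add: jconcat_def)

lemma snd_jconcat [simp]: "snd (jconcat J K) = snd J @ snd K"
  by (simp add: jconcat_def)

lemma jstart_jconcat: "fst J \<noteq> [] \<Longrightarrow> jstart (jconcat J K) = jstart J"
  by (cases "fst J" rule: remdups_adj.cases) (auto simp: jstart_def jconcat_def)

lemma jfinish_jconcat: "fst K \<noteq> [] \<Longrightarrow> jfinish (jconcat J K) = jfinish K"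
  by (cases "fst K" rule: remdups_adj.cases) (auto simp: jfinish_def jconcat_def)

text \<open>Induction on the first factor. Its last piece absorbs the first piece of
  \<open>K\<close>; each earlier jump then translates a product of classes, and translation
  distributes over products.\<close>

lemma jpath_jconcat:
  assumes "jpath J" "jpath K" "jfinish J = jstart K"
  shows "jpath (jconcat J K) \<and>
    cls (unfold (jconcat J K)) = cls (unfold J) \<odot> map inv_letter (snd J) \<bullet>\<^sub>c cls (unfold K)"
proof -
  obtain ps ss where J: "J = (ps, ss)" by fastforce
  obtain qs ts where K: "K = (qs, ts)" by fastforce
  have "jpath (ps, ss)" "jfinish (ps, ss) = jstart K"
    using assms by (auto simp: J)
  then show ?thesis
    unfolding J
  proof (induction rule: jpath_induct)
    case (Nil p)
    note Kend = unfold_ends[OF assms(2)]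
    show ?case
    \<comment> \<open>Without jumps the second factor has a single piece, which is both first and
      last; otherwise joining alters only the piece before its first jump.\<close>
    proof (cases ts)
      case Nil
      then obtain q where "qs = [q]" "path_in X q"
        using assms(2) by (auto simp: K jpath_Nil)
      with Nil \<open>path_in X p\<close> show ?thesis
        using \<open>jfinish ([p], []) = jstart K\<close>
        by (auto simp: K jconcat_single jpath_Nil class_prod_path_class jfinish_def jstart_def)
    next
      case (Cons m ts')
      then obtain q qs' where q: "qs = q # qs'"
        using assms(2) by (cases qs) (auto simp: K is_jpath_iff)
      have m: "jpath (q # qs', m # ts')"
        using assms(2) by (simp add: K Cons q)
      with \<open>path_in X p\<close> have "jpath ((p +++ q) # qs', m # ts')"
        using \<open>jfinish ([p], []) = jstart K\<close>
        by (auto simp: K q jfinish_def jstart_def jpath_Cons)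
      then show ?thesis
        using m \<open>path_in X p\<close> Kend(1)
        by (simp add: K q Cons jconcat_single class_unfold_Cons jpath_Cons class_prod_path_class
            class_prod_assoc class_act_prod class_act_act)
    qed
  next
    case (Cons p ps l ss)
    have e: "jfinish (ps, ss) = jstart K"
      using Cons.prems \<open>ps \<noteq> []\<close> by (simp add: jfinish_def)
    note IH = Cons.IH[OF e]
    have w: "map inv_letter ss \<in> words S"
      using jpath_words[OF Cons.hyps(5)] by simp
    let ?JK = "jconcat (ps, ss) K"
    have j: "jpath (p # fst ?JK, l # snd ?JK)"
      using Cons.hyps IH jstart_jconcat[of "(ps, ss)" K] jpath_nonempty[of "fst ?JK" "snd ?JK"]
      unfolding jpath_Cons by (simp add: jstart_def del: snd_jconcat)
    have "jpath (p # ps, l # ss)"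
      using Cons.hyps by (simp add: jpath_Cons)
    with j IH show ?case
      using \<open>ps \<noteq> []\<close> \<open>fst l \<in> S\<close> w
      by (simp add: jconcat_Cons class_unfold_Cons class_act_prod class_act_act class_prod_assoc
          del: snd_jconcat)
  qed
qed

text \<open>The two opposite letters together act trivially on what follows. The constant piece
  between them, pulled back by the first jump, is the constant at the end of the piece before it and
  is absorbed by what follows. By \<open>jpath_jconcat\<close> the right-hand side is the class of
  the contracted jumping-path.\<close>

lemma contraction:
  assumes "jpath (ps @ [c] @ qs, ss @ [l, inv_letter l] @ ts)" "\<forall>t\<in>{0..1}. c t = c 0"
    "length ps = Suc (length ss)" "length qs = Suc (length ts)"
  shows "jpath (ps, ss) \<and> jpath (qs, ts) \<and> jfinish (ps, ss) = jstart (qs, ts) \<and>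
    cls (unfold (ps @ [c] @ qs, ss @ [l, inv_letter l] @ ts)) =
      cls (unfold (ps, ss)) \<odot> map inv_letter ss \<bullet>\<^sub>c cls (unfold (qs, ts))"
  using assms(1,3)
proof (induction ss arbitrary: ps)
  case Nil
  then obtain p where p: "ps = [p]" by (auto simp: length_Suc_conv)
  have j: "jpath (p # c # qs, l # inv_letter l # ts)"
    using Nil.prems p by simp
  then have l: "fst l \<in> S" "path_in X p" "path_in X c" "pathstart c = word_act [l] (pathfinish p)"
     "pathstart (hd qs) = word_act [inv_letter l] (pathfinish c)" "jpath (qs, ts)"
    and j': "jpath (c # qs, inv_letter l # ts)"
    by (auto simp: jpath_Cons)
  have c: "pathfinish c = pathstart c"
    using bspec[OF assms(2), of 1] by (simp add: pathfinish_def pathstart_def)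
  \<comment> \<open>\<open>c\<close> is constant only on the unit interval, so a truly constant
    function replaces it.\<close>
  have "cls c = cls (\<lambda>_. word_act [l] (pathfinish p))"
    unfolding l(4)[symmetric] pathstart_def using bspec[OF assms(2)] by (intro path_class_cong[OF l(3)])
  then have "[inv_letter l] \<bullet>\<^sub>c cls c = cls (\<lambda>_. pathfinish p)"
    using l by (simp add: class_act_const path_in_pathfinish word_act_in)
  moreover have "[inv_letter l, l] \<bullet>\<^sub>c C = [] \<bullet>\<^sub>c C" for C
    by (intro class_act_cong) (simp add: reduce_Cons)
  moreover have "pathfinish p = pathstart (hd qs)"
    using l c by (simp add: path_in_pathfinish)
  ultimately show ?case
    using j j' l unfold_ends[OF l(6)] unfolding p
    by (simp add: class_unfold_Cons class_act_prod class_act_act jpath_Nil jfinish_def jstart_def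
        class_prod_const_left)
next
  case (Cons m ss)
  then obtain p ps' where p: "ps = p # ps'" "ps' \<noteq> []" "length ps' = Suc (length ss)"
    by (cases ps; cases "tl ps") auto
  have j: "jpath (p # ps' @ [c] @ qs, m # ss @ [l, inv_letter l] @ ts)"
    using Cons.prems p by simp
  then have j': "jpath (ps' @ [c] @ qs, ss @ [l, inv_letter l] @ ts)" and m: "fst m \<in> S"
    by (auto simp: jpath_Cons)
  note IH = Cons.IH[OF j' p(3)]
  have jm: "jpath (p # ps', m # ss)"
    using j IH p(2) by (simp add: jpath_Cons)
  have w: "map inv_letter ss \<in> words S"
    using IH jpath_words by fastforce
  show ?case
    using IH j jm m w p unfolding p(1)
    by (simp add: class_unfold_Cons class_act_prod class_act_act class_prod_assoc jfinish_def)
qed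

lemma contracts_imp:
  assumes "contracts S act X J K"
  shows "jpath J \<and> jpath K \<and> cls (unfold J) = cls (unfold K) \<and> reduce (snd J) = reduce (snd K) \<and>
    jstart J = jstart K \<and> jfinish J = jfinish K"
proof -
  obtain ps ss qs ts c l where *: "length ps = Suc (length ss)" "length qs = Suc (length ts)"
      "\<forall>t\<in>{0..1}. c t = c 0" "J = (ps @ [c] @ qs, ss @ [l, inv_letter l] @ ts)"
      "K = jconcat (ps, ss) (qs, ts)" "jpath J"
    using assms unfolding contracts_def by blast
  note c = contraction[OF *(6)[unfolded *(4)] *(3,1,2)]
  have "reduce ([l, inv_letter l] @ ts) = reduce ts"
    using cancel_cons_inv_letter[of "reduce ts" "inv_letter l"]
    by (simp add: reduce_Cons reduced_reduce)
  then have "reduce (snd J) = reduce (snd K)"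
    unfolding *(4,5) snd_jconcat snd_conv by (intro reduce_append_cong refl)
  moreover have "ps \<noteq> []" "qs \<noteq> []"
    using * by auto
  then have "jstart J = jstart K" "jfinish J = jfinish K"
    by (simp_all add: *(4,5) jstart_jconcat jfinish_jconcat) (simp_all add: jstart_def jfinish_def)
  ultimately show ?thesis
    using jpath_jconcat[of "(ps, ss)" "(qs, ts)"] c *(6) unfolding *(5) *(4) by simp
qed

section \<open>Invariance under homotopy\<close>

text \<open>The jump condition at time t makes consecutive slices meet after translation by the
  inverse letter, which is what joint continuity of a join of homotopies requires.\<close>

lemma continuous_on_unfold_homotopy:
  fixes H :: "nat \<Rightarrow> real \<times> real \<Rightarrow> 'a"
  assumes "\<And>i. i \<le> length ss \<Longrightarrow> continuous_on ({0..1} \<times> {0..1}) (H i)"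
    and "\<And>t. t \<in> {0..1} \<Longrightarrow> jchain ss (\<lambda>i u. H i (u, t))"
  shows "continuous_on ({0..1} \<times> {0..1 :: real}) (\<lambda>y. unfold_path ss (\<lambda>i u. H i (u, fst y)) (snd y))"
  using assms
proof (induction ss arbitrary: H)
  \<comment> \<open>Spatial homotopies have the path parameter first, whereas homotopies of paths
    have the time first.\<close>
  have swap: "continuous_on ({0..1} \<times> {0..1}) (\<lambda>y. h (snd y, fst y))"
    if "continuous_on ({0..1} \<times> {0..1}) h" for h :: "real \<times> real \<Rightarrow> 'a"
    using that by (rule continuous_on_compose2) (auto intro!: continuous_intros)
  {
    case Nil
    then show ?case using swap[of "H 0"] by simp
  next
    case (Cons l ss)
    let ?q = "\<lambda>t. unfold_path ss (\<lambda>i u. H (Suc i) (u, t))"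
    have ch: "jchain ss (\<lambda>i u. H (Suc i) (u, t))" "fst l \<in> S" "path_in X (\<lambda>u. H 0 (u, t))"
        "pathstart (\<lambda>u. H (Suc 0) (u, t)) = word_act [l] (pathfinish (\<lambda>u. H 0 (u, t)))"
      if "t \<in> {0..1}" for t
      using Cons.prems(2)[OF that] by auto
    have q: "continuous_on ({0..1} \<times> {0..1}) (\<lambda>y. ?q (fst y) (snd y))"
      using Cons.prems(1) ch(1) by (intro Cons.IH) auto
    have "continuous_on ({0..1} \<times> {0..1})
        (\<lambda>y. ((\<lambda>t u. H 0 (u, t)) (fst y) +++ (\<lambda>t. word_act [inv_letter l] \<circ> ?q t) (fst y)) (snd y))"
    proof (rule continuous_on_homotopic_join_lemma)
      show "continuous_on ({0..1} \<times> {0..1}) (\<lambda>y. H 0 (snd y, fst y))"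
        using Cons.prems(1)[of 0] swap[of "H 0"] by simp
      have "?q t u \<in> X" if "t \<in> {0..1}" "u \<in> {0..1}" for t u
        using path_in_value[OF conjunct1[OF unfold_path[OF ch(1)[OF that(1)]]]] that(2) by simp
      then show "continuous_on ({0..1} \<times> {0..1}) (\<lambda>y. (word_act [inv_letter l] \<circ> ?q (fst y)) (snd y))"
        unfolding o_def using ch(2)[of 0]
        by (intro continuous_on_compose2[OF continuous_word_act q]) auto
      show "pathfinish (\<lambda>u. H 0 (u, t)) = pathstart (word_act [inv_letter l] \<circ> ?q t)"
        if "t \<in> {0..1}" for t
        using ch[OF that] unfold_path[OF ch(1)[OF that]]
        by (simp add: pathstart_compose path_in_pathfinish)
    qed
    then show ?case by simp
  }
qed

definition is_spatial_homotopy ::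
  "(real \<Rightarrow> 'a) list \<Rightarrow> (real \<Rightarrow> 'a) list \<Rightarrow> 's letter list \<Rightarrow> (nat \<Rightarrow> real \<times> real \<Rightarrow> 'a) \<Rightarrow> bool" where
  "is_spatial_homotopy ps qs ss H \<longleftrightarrow>
    (\<forall>i\<le>length ss. continuous_on ({0..1} \<times> {0..1}) (H i) \<and> H i ` ({0..1} \<times> {0..1}) \<subseteq> X \<and>
      (\<forall>u\<in>{0..1}. H i (u, 0) = (ps ! i) u \<and> H i (u, 1) = (qs ! i) u)) \<and>
    (\<forall>t\<in>{0..1}. H 0 (0, t) = (ps ! 0) 0 \<and> H 0 (0, t) = (qs ! 0) 0 \<and>
      H (length ss) (1, t) = (ps ! length ss) 1 \<and> H (length ss) (1, t) = (qs ! length ss) 1 \<and>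
      (\<forall>i<length ss. H (Suc i) (0, t) = act [ss ! i] (H i (1, t))))"

lemma spatially_homotopic_iff:
  "spatially_homotopic S act X (ps, ss) (qs, ts) \<longleftrightarrow>
    jpath (ps, ss) \<and> jpath (qs, ts) \<and> ss = ts \<and> (\<exists>H. is_spatial_homotopy ps qs ss H)"
  by (auto simp: spatially_homotopic_def is_spatial_homotopy_def Let_def)

text \<open>Every slice of the homotopy is a jumping-path with the same pattern, so unfolding slice
  by slice gives a homotopy of the unfoldings. Its ends stay fixed: the start is that of the first
  piece, and the end is the fixed last end point moved by a fixed word.\<close>

lemma spatially_homotopic_imp:
  assumes "spatially_homotopic S act X J K"
  shows "jpath J \<and> jpath K \<and> cls (unfold J) = cls (unfold K) \<and> reduce (snd J) = reduce (snd K) \<and>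
    jstart J = jstart K \<and> jfinish J = jfinish K"
proof -
  obtain ps ss where J: "J = (ps, ss)" by fastforce
  obtain qs where K: "K = (qs, ss)" and jp: "jpath J" "jpath K"
    using assms by (cases K) (auto simp: spatially_homotopic_def J)
  obtain H where "is_spatial_homotopy ps qs ss H"
    using assms spatially_homotopic_iff[of ps ss qs ss] by (auto simp: J K)
  note H = conjunct1[OF this[unfolded is_spatial_homotopy_def]]
    conjunct2[OF this[unfolded is_spatial_homotopy_def]]
  have cont: "continuous_on ({0..1} \<times> {0..1}) (H i)"
    and im: "H i ` ({0..1} \<times> {0..1}) \<subseteq> X"
    and ends: "u \<in> {0..1} \<Longrightarrow> H i (u, 0) = (ps ! i) u \<and> H i (u, 1) = (qs ! i) u"
    if "i \<le> length ss" for i u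
    using H(1) that by blast+
  have fix0: "H 0 (0, t) = (ps ! 0) 0 \<and> H 0 (0, t) = (qs ! 0) 0"
    and fix1: "H (length ss) (1, t) = (ps ! length ss) 1 \<and> H (length ss) (1, t) = (qs ! length ss) 1"
    and jump: "i < length ss \<Longrightarrow> H (Suc i) (0, t) = act [ss ! i] (H i (1, t))"
    if "t \<in> {0..1}" for t i
    using H(2) that by blast+
  have "ss \<in> words S"
    using jpath_words[OF jp(1)] by (simp add: J)
  have ch: "jchain ss (\<lambda>i u. H i (u, t))" if t: "t \<in> {0..1}" for t
  proof -
    have "path_in X (\<lambda>u. H i (u, t))" if "i \<le> length ss" for i
      unfolding path_in_def path_def path_image_def
      using im[OF that] t
      by (auto intro!: continuous_on_compose2[OF cont[OF that]] continuous_intros)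
    then show ?thesis
      using \<open>ss \<in> words S\<close> jump[OF t] by (auto simp: jchain_def pathstart_def pathfinish_def act_letter)
  qed
  have len: "length ps = Suc (length ss)" "length qs = Suc (length ss)"
    using jp by (auto simp: J K is_jpath_iff)
  have e0: "unfold_path ss (\<lambda>i u. H i (u, 0)) u = unfold J u"
    and e1: "unfold_path ss (\<lambda>i u. H i (u, 1)) u = unfold K u" if "u \<in> {0..1}" for u
    unfolding unfold_def J K fst_conv snd_conv using ends that
    by (intro unfold_path_cong; simp)+
  have st: "jstart J = (ps ! 0) 0" "jfinish J = (ps ! length ss) 1"
       "jstart K = (qs ! 0) 0" "jfinish K = (qs ! length ss) 1"
    using len hd_conv_nth[of ps] hd_conv_nth[of qs] last_conv_nth[of ps] last_conv_nth[of qs]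
    by (cases ps; cases qs; simp add: J K jstart_def jfinish_def pathstart_def pathfinish_def)+
  have same: "jstart J = jstart K" "jfinish J = jfinish K"
    unfolding st using fix0[of 0] fix1[of 0] by auto
  have "homotopic_paths X (unfold J) (unfold K)"
    unfolding homotopic_paths
  proof (intro exI[of _ "\<lambda>y. unfold_path ss (\<lambda>i u. H i (u, fst y)) (snd y)"] conjI ballI)
    show "continuous_on ({0..1} \<times> {0..1}) (\<lambda>y. unfold_path ss (\<lambda>i u. H i (u, fst y)) (snd y))"
      using cont ch by (rule continuous_on_unfold_homotopy)
    show "(\<lambda>y. unfold_path ss (\<lambda>i u. H i (u, fst y)) (snd y)) \<in> {0..1} \<times> {0..1} \<rightarrow> X"
      using path_in_value[OF conjunct1[OF unfold_path[OF ch]]] by auto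
    show "unfold_path ss (\<lambda>i u. H i (u, fst (0, x))) (snd (0, x)) = unfold J x"
      "unfold_path ss (\<lambda>i u. H i (u, fst (1, x))) (snd (1, x)) = unfold K x" if "x \<in> {0..1}" for x
      using e0[OF that] e1[OF that] by auto
    fix t :: real assume t: "t \<in> {0..1}"
    have o: "(\<lambda>y. unfold_path ss (\<lambda>i u. H i (u, fst y)) (snd y)) \<circ> Pair t =
        unfold_path ss (\<lambda>i u. H i (u, t))"
      by (simp add: o_def)
    show "pathstart ((\<lambda>y. unfold_path ss (\<lambda>i u. H i (u, fst y)) (snd y)) \<circ> Pair t) = pathstart (unfold J)"
      "pathfinish ((\<lambda>y. unfold_path ss (\<lambda>i u. H i (u, fst y)) (snd y)) \<circ> Pair t) = pathfinish (unfold J)"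
      unfolding o unfold_ends(2,3)[OF jp(1)] st using unfold_path[OF ch[OF t]] fix0[OF t] fix1[OF t]
      by (auto simp: pathstart_def pathfinish_def J)
  qed
  then show ?thesis
    using jp same path_class_eqI by (simp add: J K)
qed

text \<open>\<open>jpath J\<close> has to be assumed because the reflexive closure relates every
  pair of lists to itself.\<close>

lemma jhomotopic_imp:
  assumes "jhomotopic S act X J K" "jpath J"
  shows "jpath K \<and> cls (unfold J) = cls (unfold K) \<and> reduce (snd J) = reduce (snd K) \<and>
    jstart J = jstart K \<and> jfinish J = jfinish K"
  using assms(1) unfolding jhomotopic_def
proof (induction rule: rtranclp_induct)
  case (step K L)
  then show ?case
    using spatially_homotopic_imp[of K L] contracts_imp[of K L] contracts_imp[of L K] by auto
qed (use assms in auto)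


section \<open>Normal forms of jumping-paths\<close>

lemma jhomotopic_refl: "jhomotopic S act X J J"
  by (simp add: jhomotopic_def)

lemma jhomotopic_trans:
  "jhomotopic S act X J K \<Longrightarrow> jhomotopic S act X K L \<Longrightarrow> jhomotopic S act X J L"
  unfolding jhomotopic_def by (rule rtranclp_trans)

lemma spatially_homotopic_imp_jhomotopic:
  "spatially_homotopic S act X J K \<Longrightarrow> jhomotopic S act X J K"
  unfolding jhomotopic_def by (rule r_into_rtranclp) simp

lemma contracts_imp_jhomotopic: "contracts S act X J K \<Longrightarrow> jhomotopic S act X J K"
  unfolding jhomotopic_def by (rule r_into_rtranclp) simp

section \<open>Construction of spatial homotopies\<close>

text \<open>Only the end conditions for the first jumping-path are demanded; evaluating them at time
  1 gives those for the second.\<close>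

lemma spatially_homotopicI:
  fixes H :: "nat \<Rightarrow> real \<times> real \<Rightarrow> 'a"
  assumes "jpath (ps, ss)" "jpath (qs, ss)"
    and "\<And>i. i \<le> length ss \<Longrightarrow> continuous_on ({0..1} \<times> {0..1}) (H i)"
    and "\<And>i u t. i \<le> length ss \<Longrightarrow> u \<in> {0..1} \<Longrightarrow> t \<in> {0..1} \<Longrightarrow> H i (u, t) \<in> X"
    and "\<And>i u. i \<le> length ss \<Longrightarrow> u \<in> {0..1} \<Longrightarrow> H i (u, 0) = (ps ! i) u \<and> H i (u, 1) = (qs ! i) u"
    and "\<And>t. t \<in> {0..1} \<Longrightarrow> H 0 (0, t) = (ps ! 0) 0"
    and "\<And>t. t \<in> {0..1} \<Longrightarrow> H (length ss) (1, t) = (ps ! length ss) 1"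
    and "\<And>i t. i < length ss \<Longrightarrow> t \<in> {0..1} \<Longrightarrow> H (Suc i) (0, t) = word_act [ss ! i] (H i (1, t))"
  shows "spatially_homotopic S act X (ps, ss) (qs, ss)"
proof -
  have "(qs ! 0) 0 = (ps ! 0) 0" "(qs ! length ss) 1 = (ps ! length ss) 1"
    using assms(5)[of 0 0] assms(6)[of 1] assms(5)[of "length ss" 1] assms(7)[of 1] by auto
  moreover have "H i ` ({0..1} \<times> {0..1}) \<subseteq> X" if "i \<le> length ss" for i
    using assms(4)[OF that] by blast
  ultimately show ?thesis
    unfolding spatially_homotopic_def Let_def fst_conv snd_conv act_letter
    using assms(1-3,5-8) by (intro conjI exI[of _ H] allI impI ballI) auto
qed

lemma continuous_on_fst_path:
  "path_in X p \<Longrightarrow> continuous_on ({0..1} \<times> {0..1 :: real}) (\<lambda>y. p (fst y))"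
  unfolding path_in_def path_def
  by (auto intro!: continuous_on_compose2[of "{0..1}" p] continuous_intros)

lemma jpath_nth: "jpath (ps, ss) \<Longrightarrow> i \<le> length ss \<Longrightarrow> path_in X (ps ! i)"
  by (simp add: is_jpath_iff jchain_def)

lemma jpath_nth_jump:
  "jpath (ps, ss) \<Longrightarrow> i < length ss \<Longrightarrow> (ps ! Suc i) 0 = word_act [ss ! i] ((ps ! i) 1)"
  by (simp add: is_jpath_iff jchain_def pathstart_def pathfinish_def)

text \<open>A homotopy with fixed ends does not disturb the jumps, so all other pieces can remain as
  they are.\<close>

lemma spatially_homotopic_first:
  assumes "jpath (p # ps, ss)" "homotopic_paths X p q"
  shows "spatially_homotopic S act X (p # ps, ss) (q # ps, ss)"
proof -
  obtain h where h: "continuous_on ({0..1} \<times> {0..1}) h" "h \<in> {0..1} \<times> {0..1} \<rightarrow> X"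
      "\<forall>x\<in>{0..1}. h (0, x) = p x" "\<forall>x\<in>{0..1}. h (1, x) = q x"
      "\<forall>t\<in>{0..1::real}. pathstart (h \<circ> Pair t) = pathstart p \<and> pathfinish (h \<circ> Pair t) = pathfinish p"
    using assms(2) unfolding homotopic_paths by blast
  have h01: "h (t, 0) = p 0" "h (t, 1) = p 1" if "t \<in> {0..1}" for t
    using h(5) that by (auto simp: pathstart_def pathfinish_def)
  define H where "H i = (if i = 0 then (\<lambda>y. h (snd y, fst y)) else (\<lambda>y. ((p # ps) ! i) (fst y)))" for i :: nat
  have q: "path_in X q" "pathstart q = pathstart p" "pathfinish q = pathfinish p"
    using assms(2) homotopic_paths_imp_path homotopic_paths_imp_subset homotopic_paths_imp_pathstart
      homotopic_paths_imp_pathfinish unfolding path_in_def by metis+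
  note nth = jpath_nth[OF assms(1)] jpath_nth_jump[OF assms(1)]
  have hc: "continuous_on ({0..1} \<times> {0..1}) (\<lambda>y. h (snd y, fst y))"
    by (rule continuous_on_compose2[OF h(1)]) (auto intro!: continuous_intros)
  show ?thesis
  proof (rule spatially_homotopicI[where H = H])
    show "jpath (q # ps, ss)"
      using assms(1) q by (cases ss) (auto simp: jpath_Nil jpath_Cons)
    show "continuous_on ({0..1} \<times> {0..1}) (H i)" if "i \<le> length ss" for i
      using continuous_on_fst_path[OF nth(1)[OF that]] hc by (cases i) (simp_all add: H_def)
    show "H i (u, t) \<in> X" if "i \<le> length ss" "u \<in> {0..1}" "t \<in> {0..1}" for i u t
      using path_in_value[OF nth(1)[OF that(1)]] h(2) that by (auto simp: H_def)
    show "H i (u, 0) = ((p # ps) ! i) u \<and> H i (u, 1) = ((q # ps) ! i) u"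
      if "i \<le> length ss" "u \<in> {0..1}" for i u
      using h(3,4) that by (auto simp: H_def nth_Cons')
    show "H (length ss) (1, t) = ((p # ps) ! length ss) 1" if "t \<in> {0..1}" for t
      using h01[OF that] by (simp add: H_def)
    show "H (Suc i) (0, t) = word_act [ss ! i] (H i (1, t))" if "i < length ss" "t \<in> {0..1}" for i t
      using h01[OF that(2)] nth(2)[OF that(1)] by (auto simp: H_def)
  qed (use assms(1) h01 in \<open>auto simp: H_def\<close>)
qed

text \<open>A spatial homotopy keeps the start of its first piece fixed. A further piece
  \<open>p\<close> in front can thus stay unchanged, and the jump from its end is valid at every
  time.\<close>

lemma spatially_homotopic_Cons:
  assumes "spatially_homotopic S act X (ps, ss) (qs, ts)" "jpath (p # ps, l # ss)"
  shows "spatially_homotopic S act X (p # ps, l # ss) (p # qs, l # ts)"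
proof -
  have jp: "jpath (ps, ss)" "jpath (qs, ts)" and ts: "ts = ss"
    using assms(1) by (auto simp: spatially_homotopic_def)
  have same: "jstart (ps, ss) = jstart (qs, ts)"
    using spatially_homotopic_imp[OF assms(1)] by blast
  obtain H where "is_spatial_homotopy ps qs ss H"
    using assms(1) by (auto simp: spatially_homotopic_iff)
  note H = conjunct1[OF this[unfolded is_spatial_homotopy_def]]
    conjunct2[OF this[unfolded is_spatial_homotopy_def]]
  define H' where "H' i = (case i of 0 \<Rightarrow> (\<lambda>y. p (fst y)) | Suc j \<Rightarrow> H j)" for i
  have p: "path_in X p" "fst l \<in> S"
    using assms(2) by (auto simp: jpath_Cons)
  note jump = jpath_nth_jump[OF assms(2), of 0]
  show ?thesis
    unfolding ts
  proof (rule spatially_homotopicI[where H = H'])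
    show "jpath (p # qs, l # ss)"
      using assms(2) jp same by (auto simp: ts jpath_Cons jstart_def jpath_nonempty)
    show "continuous_on ({0..1} \<times> {0..1}) (H' i)" if "i \<le> length (l # ss)" for i
      using that H(1) continuous_on_fst_path[OF p(1)] by (auto simp: H'_def split: nat.splits)
    show "H' i (u, t) \<in> X" if "i \<le> length (l # ss)" "u \<in> {0..1}" "t \<in> {0..1}" for i u t
    proof (cases i)
      case (Suc j)
      then have "H j ` ({0..1} \<times> {0..1}) \<subseteq> X" using H(1) that by auto
      then show ?thesis using that Suc by (auto simp: H'_def)
    qed (use that path_in_value[OF p(1)] in \<open>auto simp: H'_def\<close>)
    show "H' i (u, 0) = ((p # ps) ! i) u \<and> H' i (u, 1) = ((p # qs) ! i) u"
      if "i \<le> length (l # ss)" "u \<in> {0..1}" for i u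
      using that H(1) by (cases i) (auto simp: H'_def)
    show "H' (length (l # ss)) (1, t) = ((p # ps) ! length (l # ss)) 1" if "t \<in> {0..1}" for t
      using H(2) that by (simp add: H'_def)
    show "H' (Suc i) (0, t) = word_act [(l # ss) ! i] (H' i (1, t))"
      if "i < length (l # ss)" "t \<in> {0..1}" for i t
      using that H(2) jump by (cases i) (auto simp: H'_def act_letter)
  qed (use assms(2) in \<open>auto simp: H'_def\<close>)
qed

lemma contracts_Cons:
  assumes "contracts S act X (ps, ss) (qs, ts)" "jpath (p # ps, l # ss)"
  shows "contracts S act X (p # ps, l # ss) (p # qs, l # ts)"
proof -
  obtain ps' ss' qs' ts' c m where *: "length ps' = Suc (length ss')" "length qs' = Suc (length ts')"
      "\<forall>t\<in>{0..1}. c t = c 0" "(ps, ss) = (ps' @ [c] @ qs', ss' @ [m, inv_letter m] @ ts')"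
      "(qs, ts) = jconcat (ps', ss') (qs', ts')"
    using assms(1) unfolding contracts_def by blast
  have "ps' \<noteq> []" using *(1) by auto
  then have "(p # qs, l # ts) = jconcat (p # ps', l # ss') (qs', ts')"
    by (simp add: jconcat_Cons flip: *(5))
  note K = this
  show ?thesis
    unfolding contracts_def
  proof (intro conjI exI)
    show "length (p # ps') = Suc (length (l # ss'))" using *(1) by simp
    show "(p # ps, l # ss) = ((p # ps') @ [c] @ qs', (l # ss') @ [m, inv_letter m] @ ts')"
      using *(4) by simp
  qed (fact assms(2) * K)+
qed

text \<open>No move changes the start point, so every member of the chain from
  \<open>(ps, ss)\<close> to \<open>(qs, ts)\<close> can be preceded by \<open>p\<close> and the
  jump \<open>l\<close>.\<close>

lemma jhomotopic_Cons:
  assumes "jhomotopic S act X (ps, ss) (qs, ts)" "jpath (p # ps, l # ss)"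
  shows "jhomotopic S act X (p # ps, l # ss) (p # qs, l # ts)"
proof -
  have "jhomotopic S act X (p # ps, l # ss) (p # fst K, l # snd K)"
    if "jhomotopic S act X (ps, ss) K" for K
    using that[unfolded jhomotopic_def]
  proof (induction rule: rtranclp_induct)
    case base
    then show ?case by (simp add: jhomotopic_refl)
  next
    case (step K L)
    have j: "jpath (p # fst K, l # snd K)" if "jhomotopic S act X (ps, ss) K" for K
      using jhomotopic_imp[OF that] assms(2) jpath_nonempty[of "fst K" "snd K"]
      by (auto simp: jpath_Cons jstart_def)
    have K: "jpath (p # fst K, l # snd K)" and L: "jpath (p # fst L, l # snd L)"
      using step.hyps by (auto simp: jhomotopic_def intro!: j elim: rtranclp.rtrancl_into_rtrancl)
    have "spatially_homotopic S act X (p # fst K, l # snd K) (p # fst L, l # snd L) \<or>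
        contracts S act X (p # fst K, l # snd K) (p # fst L, l # snd L) \<or>
        contracts S act X (p # fst L, l # snd L) (p # fst K, l # snd K)"
      using step.hyps(2) spatially_homotopic_Cons[OF _ K, of "fst L" "snd L"]
        contracts_Cons[OF _ K, of "fst L" "snd L"] contracts_Cons[OF _ L, of "fst K" "snd K"]
      by auto
    then show ?case
      using step.IH unfolding jhomotopic_def by (rule rtranclp.rtrancl_into_rtrancl[rotated])
  qed
  from this[OF assms(1)] show ?thesis by simp
qed

text \<open>At time \<open>t\<close> the initial segment of \<open>q\<close> of length \<open>t\<close> has been pulled back through the jump.\<close>

lemma spatially_homotopic_slide:
  assumes "jpath (p # q # ps, l # ss)"
  shows "spatially_homotopic S act X (p # q # ps, l # ss)
    ((p +++ (word_act [inv_letter l] \<circ> q)) # (\<lambda>_. pathfinish q) # ps, l # ss)"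
proof -
  define r where "r = p +++ (word_act [inv_letter l] \<circ> q)"
  have p: "path_in X p" "fst l \<in> S" "path_in X q" "pathstart q = word_act [l] (pathfinish p)"
    and j: "jpath (q # ps, ss)"
    using assms by (cases ss; auto simp: jpath_Cons jpath_Nil)+
  have r: "path_in X r" "pathfinish r = word_act [inv_letter l] (pathfinish q)"
    using p by (auto simp: r_def pathstart_compose pathfinish_compose path_in_pathfinish)
  \<comment> \<open>At time t the first piece is \<open>r\<close> on [0, (1 + t)/2] and the second
    is \<open>q\<close> on [t, 1], both rescaled to the unit interval. They fit because the value of
    \<open>r\<close> at (1 + t)/2 is that of \<open>q\<close> at t, pulled back.\<close>
  define H where "H i = (if i = 0 then (\<lambda>y. r (fst y * (1 + snd y) / 2))
     else if i = 1 then (\<lambda>y. q (1 - (1 - fst y) * (1 - snd y)))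
     else (\<lambda>y. ((p # q # ps) ! i) (fst y)))" for i :: nat
  note nth = jpath_nth[OF assms] jpath_nth_jump[OF assms]
  have b0: "u * (1 + t) / 2 \<in> {0..1}" if "u \<in> {0..1}" "t \<in> {0..1}" for u t :: real
    using that mult_mono[of u 1 "1 + t" 2] by auto
  have b1: "1 - (1 - u) * (1 - t) \<in> {0..1}" if "u \<in> {0..1}" "t \<in> {0..1}" for u t :: real
    using that mult_mono[of "1 - u" 1 "1 - t" 1] by auto
  have c0: "continuous_on ({0..1} \<times> {0..1}) (\<lambda>y. r (fst y * (1 + snd y) / 2))"
  proof (rule continuous_on_compose2[where g = r])
    show "continuous_on {0..1} r"
      using r(1) by (simp add: path_in_def path_def)
    show "(\<lambda>y. fst y * (1 + snd y) / 2) ` ({0..1} \<times> {0..1}) \<subseteq> {0..1::real}"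
      using b0 by (intro image_subsetI) (simp only: mem_Times_iff)
  qed (auto intro!: continuous_intros)
  have c1: "continuous_on ({0..1} \<times> {0..1}) (\<lambda>y. q (1 - (1 - fst y) * (1 - snd y)))"
  proof (rule continuous_on_compose2[where g = q])
    show "continuous_on {0..1} q"
      using p(3) by (simp add: path_in_def path_def)
    show "(\<lambda>y. 1 - (1 - fst y) * (1 - snd y)) ` ({0..1} \<times> {0..1}) \<subseteq> {0..1::real}"
      using b1 by (intro image_subsetI) (simp only: mem_Times_iff)
  qed (auto intro!: continuous_intros)
  have "spatially_homotopic S act X (p # q # ps, l # ss) (r # (\<lambda>_. pathfinish q) # ps, l # ss)"
  proof (rule spatially_homotopicI[where H = H])
    have "jpath ((\<lambda>_. pathfinish q) # ps, ss)"
      using j by (cases ss) (auto simp: jpath_Nil jpath_Cons path_in_pathfinish)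
    then show "jpath (r # (\<lambda>_. pathfinish q) # ps, l # ss)"
      using p r by (simp add: jpath_Cons path_in_pathfinish)
    show "continuous_on ({0..1} \<times> {0..1}) (H i)" if "i \<le> length (l # ss)" for i
      using continuous_on_fst_path[OF nth(1)[OF that]] c0 c1 by (simp add: H_def del: nth_Cons_pos)
    show "H i (u, t) \<in> X" if "i \<le> length (l # ss)" "u \<in> {0..1}" "t \<in> {0..1}" for i u t
      using path_in_value[OF nth(1)[OF that(1)]] path_in_value[OF p(3)] path_in_value[OF r(1)]
        b0[OF that(2,3)] b1[OF that(2,3)] that by (auto simp: H_def)
    show "H i (u, 0) = ((p # q # ps) ! i) u \<and> H i (u, 1) = ((r # (\<lambda>_. pathfinish q) # ps) ! i) u"
      if "i \<le> length (l # ss)" "u \<in> {0..1}" for i u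
      using that by (auto simp: H_def nth_Cons' r_def joinpaths_def pathfinish_def)
    show "H 0 (0, t) = ((p # q # ps) ! 0) 0" if "t \<in> {0..1}" for t
      by (simp add: H_def r_def joinpaths_def)
    show "H (length (l # ss)) (1, t) = ((p # q # ps) ! length (l # ss)) 1" if "t \<in> {0..1}" for t
      by (simp add: H_def)
    show "H (Suc i) (0, t) = word_act [(l # ss) ! i] (H i (1, t))"
      if "i < length (l # ss)" "t \<in> {0..1}" for i t
    proof -
      consider "i = 0" | "i = 1" | "i > 1" by linarith
      then show ?thesis
      proof cases
        case 1
        have "word_act [l] (r ((1 + t) / 2)) = q t"
        \<comment> \<open>At time 0 the argument is 1/2, where the join still takes the value of
          \<open>p\<close>; here the jump from \<open>p\<close> to \<open>q\<close> is used.\<close>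
        proof (cases "t = 0")
          case True
          then show ?thesis using p(4) by (simp add: r_def joinpaths_def pathstart_def pathfinish_def)
        next
          case False
          then have "r ((1 + t) / 2) = word_act [inv_letter l] (q t)"
            using that by (simp add: r_def joinpaths_def add_divide_distrib)
          then show ?thesis using p path_in_value[OF p(3)] that by simp
        qed
        then show ?thesis using 1 by (simp add: H_def)
      next
        case 2
        then show ?thesis using nth(2)[OF that(1)] by (simp add: H_def)
      next
        case 3
        then show ?thesis using nth(2)[OF that(1)] by (simp add: H_def)
      qed
    qed
  qed (rule assms)
  then show ?thesis by (simp only: r_def)
qed

section \<open>Reduction to a path followed by jumps of a resting point\<close>

primrec jump_trace :: "'a \<Rightarrow> 's letter list \<Rightarrow> (real \<Rightarrow> 'a) list" where
  "jump_trace x [] = []"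
| "jump_trace x (l # ss) = (\<lambda>_. word_act [l] x) # jump_trace (word_act [l] x) ss"

text \<open>All motion precedes the first jump, and the rest is determined by
  \<open>pathfinish p\<close> and \<open>ss\<close>. Normal forms with the same pattern whose first
  pieces end at the same point differ in that piece only.\<close>

definition normal_jpath :: "(real \<Rightarrow> 'a) \<Rightarrow> 's letter list \<Rightarrow> ('s, 'a) jpath" where
  "normal_jpath p ss = (p # jump_trace (pathfinish p) ss, ss)"

lemma normal_jpath_Nil: "normal_jpath p [] = ([p], [])"
  by (simp add: normal_jpath_def)

lemma normal_jpath_Cons:
  "normal_jpath p (l # ss) =
    (p # fst (normal_jpath (\<lambda>_. word_act [l] (pathfinish p)) ss), l # ss)"
  by (simp add: normal_jpath_def)

lemma snd_normal_jpath [simp]: "snd (normal_jpath p ss) = ss"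
  by (simp add: normal_jpath_def)

text \<open>Pulled back through the jumps, each resting piece becomes the constant at the end of
  \<open>p\<close> and is absorbed.\<close>

lemma jpath_normal_jpath:
  "path_in X p \<Longrightarrow> ss \<in> words S \<Longrightarrow> jpath (normal_jpath p ss) \<and> cls (unfold (normal_jpath p ss)) = cls p"
proof (induction ss arbitrary: p)
  case Nil
  then show ?case by (simp add: normal_jpath_Nil jpath_Nil)
next
  case (Cons l ss)
  let ?c = "\<lambda>_::real. word_act [l] (pathfinish p)"
  have fin: "pathfinish p \<in> X" "fst l \<in> S" "ss \<in> words S"
    using Cons.prems by (auto simp: path_in_pathfinish)
  then have c: "path_in X ?c" by (simp add: word_act_in)
  note IH = Cons.IH[OF c fin(3)]
  have e: "normal_jpath ?c ss = (fst (normal_jpath ?c ss), ss)"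
    by (simp add: normal_jpath_def)
  have j: "jpath (p # fst (normal_jpath ?c ss), l # ss)"
    using IH Cons.prems e by (simp add: jpath_Cons normal_jpath_def)
  have "cls (unfold (normal_jpath p (l # ss))) = cls p \<odot> [inv_letter l] \<bullet>\<^sub>c cls ?c"
    using IH e by (simp add: normal_jpath_Cons class_unfold_Cons[OF j])
  also have "\<dots> = cls p"
    using Cons.prems fin by (simp add: class_act_const word_act_in class_prod_const_right)
  finally show ?case
    using j by (simp add: normal_jpath_Cons)
qed

text \<open>The slides are made from the last jump to the first. By induction the motion of the tail
  sits in a single piece, so one slide through the first jump moves all of it.\<close>

lemma jhomotopic_normal_jpath:
  assumes "jpath J"
  shows "jhomotopic S act X J (normal_jpath (unfold J) (snd J))"
proof -
  obtain ps ss where J: "J = (ps, ss)" by fastforce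
  from assms show ?thesis
    unfolding J snd_conv
  proof (induction rule: jpath_induct)
    case (Nil p)
    then show ?case by (simp add: unfold_def normal_jpath_Nil jhomotopic_refl)
  next
    case (Cons p ps l ss)
    let ?U = "unfold (ps, ss)"
    note U = unfold_ends[OF Cons.hyps(5)]
    have jp: "jpath (p # ps, l # ss)"
      using Cons.hyps by (simp add: jpath_Cons)
    have u: "unfold (p # ps, l # ss) = p +++ (word_act [inv_letter l] \<circ> ?U)"
      by (simp add: unfold_def)
    have 1: "jhomotopic S act X (p # ps, l # ss) (p # ?U # jump_trace (pathfinish ?U) ss, l # ss)"
      using Cons.IH jp unfolding normal_jpath_def by (rule jhomotopic_Cons)
    \<comment> \<open>The resting pieces left by the slide are those of the normal form: jumping by
      \<open>l\<close> undoes the translation by \<open>inv_letter l\<close> at the end of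
      \<open>?U\<close>.\<close>
    have "spatially_homotopic S act X (p # ?U # jump_trace (pathfinish ?U) ss, l # ss)
        (normal_jpath (unfold (p # ps, l # ss)) (l # ss))"
      using spatially_homotopic_slide[of p ?U "jump_trace (pathfinish ?U) ss" l ss]
        jhomotopic_imp[OF 1 jp] Cons.hyps(1) U(1)
      by (simp add: normal_jpath_def u pathfinish_compose path_in_pathfinish)
    then show ?case
      using 1 jhomotopic_trans spatially_homotopic_imp_jhomotopic by blast
  qed
qed

text \<open>Follows the recursion of \<open>reduce\<close>: the tail of the pattern is reduced
  behind the first jump, and a cancellation made by \<open>cancel_cons\<close> is a
  contraction.\<close>

lemma jhomotopic_reduce:
  assumes "path_in X p" "ss \<in> words S"
  shows "jhomotopic S act X (normal_jpath p ss) (normal_jpath p (reduce ss))"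
  using assms
proof (induction ss arbitrary: p)
  case Nil
  then show ?case by (simp add: jhomotopic_refl)
next
  case (Cons l ss)
  let ?c = "\<lambda>_::real. word_act [l] (pathfinish p)"
  have fin: "pathfinish p \<in> X" "fst l \<in> S" "ss \<in> words S"
    using Cons.prems by (auto simp: path_in_pathfinish)
  then have c: "path_in X ?c" by (simp add: word_act_in)
  have "jpath (p # fst (normal_jpath ?c ss), l # ss)"
    using jpath_normal_jpath[of p "l # ss"] Cons.prems by (simp add: normal_jpath_Cons)
  then have 1: "jhomotopic S act X (normal_jpath p (l # ss)) (normal_jpath p (l # reduce ss))"
    using Cons.IH[OF c fin(3)] unfolding normal_jpath_Cons
    by (intro jhomotopic_Cons) (simp_all add: normal_jpath_def)
  have "jhomotopic S act X (normal_jpath p (l # reduce ss)) (normal_jpath p (cancel_cons l (reduce ss)))"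
  proof (cases "\<exists>w. reduce ss = inv_letter l # w")
    case False
    then have "cancel_cons l (reduce ss) = l # reduce ss"
      by (cases "reduce ss") auto
    then show ?thesis by (simp add: jhomotopic_refl)
  next
    case True
    then obtain w where w: "reduce ss = inv_letter l # w" by blast
    let ?e = "\<lambda>_::real. pathfinish p"
    have words: "l # inv_letter l # w \<in> words S"
      using reduce_words[OF fin(3)] fin(2) unfolding w by simp
    \<comment> \<open>After \<open>l\<close> and its inverse the point is back at
      \<open>pathfinish p\<close>, so the remaining pieces are the trace of \<open>w\<close> from
      there.\<close>
    have n: "normal_jpath p (l # inv_letter l # w) =
        ([p] @ [?c] @ (?e # jump_trace (pathfinish p) w), [] @ [l, inv_letter l] @ w)"
      using fin by (simp add: normal_jpath_def)
    have len: "length (jump_trace x v) = length v" for x v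
      by (induction v arbitrary: x) auto
    have con: "contracts S act X (normal_jpath p (l # inv_letter l # w))
        (jconcat ([p], []) (?e # jump_trace (pathfinish p) w, w))"
      unfolding contracts_def
    proof (intro conjI exI)
      show "jpath (normal_jpath p (l # inv_letter l # w))"
        using jpath_normal_jpath[OF Cons.prems(1) words] by blast
      show "normal_jpath p (l # inv_letter l # w) =
          ([p] @ [?c] @ (?e # jump_trace (pathfinish p) w), [] @ [l, inv_letter l] @ w)"
        by (rule n)
    qed (simp_all add: len)
    \<comment> \<open>The contraction joins \<open>p\<close> to the resting piece behind the two
      jumps; a spatial homotopy of the first piece removes this rest.\<close>
    have "jpath ((p +++ ?e) # jump_trace (pathfinish p) w, w)"
      using contracts_imp[OF con] by (simp add: jconcat_single)
    then have "spatially_homotopic S act X ((p +++ ?e) # jump_trace (pathfinish p) w, w) (normal_jpath p w)"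
      unfolding normal_jpath_def using homotopic_paths_const_right[OF Cons.prems(1)]
      by (rule spatially_homotopic_first)
    then show ?thesis
      using contracts_imp_jhomotopic[OF con] jhomotopic_trans spatially_homotopic_imp_jhomotopic
      by (simp add: w jconcat_single)
  qed
  with 1 show ?case
    unfolding reduce_Cons by (rule jhomotopic_trans)
qed

section \<open>Completeness of the invariants\<close>

text \<open>\<open>jhomotopic\<close> contains contractions in both directions by definition;
  spatial homotopies are inverted by reversing time.\<close>

lemma spatially_homotopic_sym:
  assumes "spatially_homotopic S act X J K"
  shows "spatially_homotopic S act X K J"
proof -
  obtain ps ss where J: "J = (ps, ss)" by fastforce
  obtain qs where K: "K = (qs, ss)" and jp: "jpath (ps, ss)" "jpath (qs, ss)"
    using assms by (cases K) (auto simp: spatially_homotopic_def J)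
  obtain H where "is_spatial_homotopy ps qs ss H"
    using assms spatially_homotopic_iff[of ps ss qs ss] by (auto simp: J K)
  note H = conjunct1[OF this[unfolded is_spatial_homotopy_def]]
    conjunct2[OF this[unfolded is_spatial_homotopy_def]]
  have same: "(ps ! 0) 0 = (qs ! 0) 0" "(ps ! length ss) 1 = (qs ! length ss) 1"
    using bspec[OF H(2), of 0] by auto
  show ?thesis
    unfolding J K
  proof (rule spatially_homotopicI[where H = "\<lambda>i y. H i (fst y, 1 - snd y)"])
    show "continuous_on ({0..1} \<times> {0..1}) (\<lambda>y. H i (fst y, 1 - snd y))" if "i \<le> length ss" for i
    proof (rule continuous_on_compose2[where g = "H i"])
      show "continuous_on ({0..1} \<times> {0..1}) (H i)" using H(1) that by blast
    qed (auto intro!: continuous_intros)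
    show "H i (fst (u, t), 1 - snd (u, t)) \<in> X" if "i \<le> length ss" "u \<in> {0..1}" "t \<in> {0..1}" for i u t
    proof -
      have "H i ` ({0..1} \<times> {0..1}) \<subseteq> X" using H(1) that by blast
      moreover have "(u, 1 - t) \<in> {0..1} \<times> {0..1}" using that by auto
      ultimately show ?thesis by auto
    qed
  qed (use jp H same in \<open>auto simp: act_letter\<close>)
qed

lemma jhomotopic_sym: "jhomotopic S act X J K \<Longrightarrow> jhomotopic S act X K J"
  unfolding jhomotopic_def
  by (rule sympD[OF symp_rtranclp]) (auto simp: symp_def intro: spatially_homotopic_sym)

lemma jhomotopic_iff:
  assumes "jpath J" "jpath K"
  shows "jhomotopic S act X J K \<longleftrightarrow>
    cls (unfold J) = cls (unfold K) \<and> reduce (snd J) = reduce (snd K)"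
proof (intro iffI conjI; (elim conjE)?)
  assume e: "cls (unfold J) = cls (unfold K)" "reduce (snd J) = reduce (snd K)"
  let ?N = "\<lambda>L. normal_jpath (unfold L) (reduce (snd L))"
  have N: "jhomotopic S act X L (?N L)" if "jpath L" for L
    using jhomotopic_normal_jpath[OF that] jhomotopic_reduce[OF unfold_ends(1)[OF that] jpath_words[OF that]]
    by (rule jhomotopic_trans)
  have hom: "homotopic_paths X (unfold J) (unfold K)"
    using e(1) unfold_ends(1)[OF assms(1)] by (simp add: path_class_eq_iff)
  have "jpath (?N J)"
    using jpath_normal_jpath unfold_ends(1)[OF assms(1)] jpath_words[OF assms(1)] reduce_words by blast
  \<comment> \<open>Homotopic unfoldings have the same end, so both normal forms have the same
    resting pieces.\<close>
  then have "spatially_homotopic S act X (?N J) (?N K)"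
    using spatially_homotopic_first[OF _ hom] homotopic_paths_imp_pathfinish[OF hom] e(2)
    by (simp add: normal_jpath_def)
  then show "jhomotopic S act X J K"
    using N[OF assms(1)] jhomotopic_sym[OF N[OF assms(2)]]
      spatially_homotopic_imp_jhomotopic jhomotopic_trans by blast
qed (use jhomotopic_imp assms in auto)

lemma jclass_eq_iff:
  assumes "jpath J" "jpath K"
  shows "jclass S act X J = jclass S act X K \<longleftrightarrow>
    cls (unfold J) = cls (unfold K) \<and> reduce (snd J) = reduce (snd K)"
proof -
  have "jclass S act X J = jclass S act X K \<longleftrightarrow> jhomotopic S act X J K"
    unfolding jclass_def using jhomotopic_refl jhomotopic_sym jhomotopic_trans by blast
  then show ?thesis using jhomotopic_iff[OF assms] by simp
qed

end


section \<open>The isomorphism\<close>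

locale based_free_action = free_action S X act
  for S :: "'s set" and X :: "'a::metric_space set" and act :: "'s letter list \<Rightarrow> 'a \<Rightarrow> 'a" +
  fixes x0 :: 'a and \<alpha> :: "'s \<Rightarrow> real \<Rightarrow> 'a"
  assumes x0: "x0 \<in> X"
    and alpha: "s \<in> S \<Longrightarrow> path (\<alpha> s) \<and> path_image (\<alpha> s) \<subseteq> X \<and>
      pathstart (\<alpha> s) = x0 \<and> pathfinish (\<alpha> s) = act [(s, True)] x0"
begin

lemma alpha_letter:
  assumes "fst l \<in> S"
  shows "path_in X (alpha_letter act \<alpha> l)" "pathstart (alpha_letter act \<alpha> l) = x0"
    "pathfinish (alpha_letter act \<alpha> l) = word_act [l] x0"
proof -
  obtain s b where l: "l = (s, b)" by fastforce
  have s: "path_in X (\<alpha> s)" "pathstart (\<alpha> s) = x0" "pathfinish (\<alpha> s) = word_act [(s, True)] x0" "s \<in> S"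
    using alpha[of s] assms by (auto simp: l path_in_def act_letter)
  have inv: "inv_letter (s, True) = (s, False)" by (simp add: inv_letter_def)
  show "path_in X (alpha_letter act \<alpha> l)" "pathstart (alpha_letter act \<alpha> l) = x0"
    "pathfinish (alpha_letter act \<alpha> l) = word_act [l] x0"
    using s word_act_inv_letter(1)[of "(s, True)" x0] x0
    by (cases b; simp add: l alpha_letter_def act_letter pathstart_compose pathfinish_compose inv)+
qed

text \<open>The choice of alpha on inverse letters is symmetric in a letter and its inverse. This is
  the cancellation behind \<open>class_alpha_path_reduce\<close>.\<close>

lemma class_act_alpha_letter_inv:
  assumes "fst l \<in> S"
  shows "[l] \<bullet>\<^sub>c cls (alpha_letter act \<alpha> (inv_letter l)) = cls (reversepath (alpha_letter act \<alpha> l))"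
proof -
  obtain s b where l: "l = (s, b)" by fastforce
  have s: "path_in X (\<alpha> s)" "s \<in> S"
    using alpha[of s] assms by (auto simp: l path_in_def)
  show ?thesis
  proof (cases b)
    case True
    have "[(s, True)] \<bullet>\<^sub>c cls (word_act [(s, False)] \<circ> reversepath (\<alpha> s)) =
        [(s, True), (s, False)] \<bullet>\<^sub>c cls (reversepath (\<alpha> s))"
      using s by (simp add: class_act_path_class class_act_act)
    also have "\<dots> = [] \<bullet>\<^sub>c cls (reversepath (\<alpha> s))"
      by (intro class_act_cong) (simp add: reduce_Cons inv_letter_def)
    finally show ?thesis
      using s by (simp add: l True alpha_letter_def inv_letter_def act_letter)
  next
    case False
    then show ?thesis
      using s by (simp add: l alpha_letter_def inv_letter_def act_letter class_act_path_class[symmetric]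
          flip: path_compose_reversepath)
  qed
qed

section \<open>The cocycle of paths along words\<close>

text \<open>A variant of \<open>alpha_word\<close> in the same homotopy class. It translates the
  whole tail by the first letter instead of each segment by its prefix, which suits induction on
  words.\<close>

primrec alpha_path :: "'s letter list \<Rightarrow> real \<Rightarrow> 'a" where
  "alpha_path [] = (\<lambda>_. x0)"
| "alpha_path (l # w) = alpha_letter act \<alpha> l +++ (word_act [l] \<circ> alpha_path w)"

lemma alpha_path:
  assumes "w \<in> words S"
  shows "path_in X (alpha_path w) \<and> pathstart (alpha_path w) = x0 \<and> pathfinish (alpha_path w) = word_act w x0"
  using assms
proof (induction w)
  case (Cons l w)
  then show ?case
    using alpha_letter[of l] word_act_Cons[of l w x0] x0
    by (simp add: pathstart_compose pathfinish_compose)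
qed (simp add: x0)

lemma class_alpha_path_Cons:
  "fst l \<in> S \<Longrightarrow> w \<in> words S \<Longrightarrow>
    cls (alpha_path (l # w)) = cls (alpha_letter act \<alpha> l) \<odot> [l] \<bullet>\<^sub>c cls (alpha_path w)"
  by (simp add: alpha_letter alpha_path class_prod_path_class class_act_path_class)

text \<open>The cocycle rule: up to homotopy, alpha is a crossed homomorphism into the fundamental
  groupoid.\<close>

lemma class_alpha_path_append:
  assumes "u \<in> words S" "v \<in> words S"
  shows "cls (alpha_path (u @ v)) = cls (alpha_path u) \<odot> u \<bullet>\<^sub>c cls (alpha_path v)"
  using assms
proof (induction u)
  case Nil
  then show ?case by (simp add: alpha_path class_prod_const_left)
next
  case (Cons l u)
  then show ?case
    by (simp add: class_alpha_path_Cons class_act_prod class_act_act class_prod_assoc del: alpha_path.simps)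
qed

text \<open>For a cancelling pair the cocycle rule yields the path of \<open>l\<close> followed by
  its reverse, which is trivial. So the class depends only on the element of the free group.\<close>

lemma class_alpha_path_reduce: "w \<in> words S \<Longrightarrow> cls (alpha_path (reduce w)) = cls (alpha_path w)"
proof (induction w)
  case (Cons l w)
  then have l: "fst l \<in> S" "w \<in> words S" by simp_all
  have "cls (alpha_path (l # w)) = cls (alpha_path (l # reduce w))"
    using Cons l by (simp add: class_alpha_path_Cons reduce_words del: alpha_path.simps)
  also have "\<dots> = cls (alpha_path (cancel_cons l (reduce w)))"
  proof (cases "\<exists>v. reduce w = inv_letter l # v")
    case False
    then show ?thesis by (cases "reduce w") auto
  next
    case True
    then obtain v where v: "reduce w = inv_letter l # v" by blast
    then have v': "v \<in> words S" using reduce_words[OF l(2)] by simp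
    have "[l, inv_letter l] \<bullet>\<^sub>c C = [] \<bullet>\<^sub>c C" for C
      by (intro class_act_cong) (simp add: reduce_Cons)
    then show ?thesis
      using l v' alpha_letter[OF l(1)] alpha_path[OF v']
      by (simp add: v class_alpha_path_Cons class_act_prod class_act_act class_act_alpha_letter_inv
          class_prod_reversepath_right' class_prod_const_left del: alpha_path.simps)
  qed
  finally show ?case by (simp add: reduce_Cons)
qed simp

text \<open>The prefix \<open>v\<close> is general because removing the first letter of
  \<open>w\<close> appends it to the prefix of all later segments. The empty word is excluded: its
  concatenation rests at \<open>x0\<close> and not at the translate by \<open>v\<close>.\<close>

lemma class_path_concat:
  assumes "v \<in> words S" "w \<in> words S" "w \<noteq> []"
  shows "let p = path_concat x0 (map (\<lambda>i. word_act (v @ take i w) \<circ> alpha_letter act \<alpha> (w ! i)) [0..<length w])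
    in path_in X p \<and> pathstart p = word_act v x0 \<and> cls p = v \<bullet>\<^sub>c cls (alpha_path w)"
  using assms
proof (induction w arbitrary: v)
  case (Cons l w)
  let ?seg = "\<lambda>v w. map (\<lambda>i. word_act (v @ take i w) \<circ> alpha_letter act \<alpha> (w ! i)) [0..<length w]"
  have l: "fst l \<in> S" "w \<in> words S"
    using Cons.prems by auto
  note al = alpha_letter[OF l(1)]
  have seg: "?seg v (l # w) = (word_act v \<circ> alpha_letter act \<alpha> l) # ?seg (v @ [l]) w"
    unfolding length_Cons map_upt_Suc by simp
  have vl: "word_act (v @ [l]) x0 = word_act v (word_act [l] x0)"
    using Cons.prems l x0 by (simp add: word_act_append)
  show ?case
  \<comment> \<open>For one path \<open>path_concat\<close> adds no constant, whereas
    \<open>alpha_path\<close> ends in one, which is absorbed on the right.\<close>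
  proof (cases "w = []")
    case True
    then have "path_concat x0 (?seg v (l # w)) = word_act v \<circ> alpha_letter act \<alpha> l"
      unfolding seg by simp
    then show ?thesis
      using Cons.prems al True
      by (simp only: Let_def) (simp add: pathstart_compose class_act_path_class class_alpha_path_Cons class_act_const
          x0 class_prod_const_right del: alpha_path.simps(2))
  next
    case False
    then obtain q qs where q: "?seg (v @ [l]) w = q # qs"
      by (cases "?seg (v @ [l]) w") auto
    have IH: "path_in X (path_concat x0 (q # qs))"
        "pathstart (path_concat x0 (q # qs)) = word_act v (word_act [l] x0)"
        "cls (path_concat x0 (q # qs)) = (v @ [l]) \<bullet>\<^sub>c cls (alpha_path w)"
      using Cons.IH[of "v @ [l]"] Cons.prems False unfolding q Let_def vl by auto
    then show ?thesis
      using Cons.prems al unfolding seg q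
      by (simp add: Let_def pathstart_compose pathfinish_compose class_prod_path_class class_act_path_class
          class_alpha_path_Cons class_act_prod class_act_act del: alpha_path.simps)
  qed
qed simp

lemma class_alpha_word:
  assumes "w \<in> words S"
  shows "cls (alpha_word act x0 \<alpha> w) = cls (alpha_path w)"
proof (cases "w = []")
  case False
  then show ?thesis
    using class_path_concat[of "[]" w] alpha_path[OF assms] assms
    by (simp add: Let_def alpha_word_def word_act_def)
qed (simp add: alpha_word_def)

lemma alpha_word:
  assumes "w \<in> words S"
  shows "path_in X (alpha_word act x0 \<alpha> w)" "pathstart (alpha_word act x0 \<alpha> w) = x0"
    "pathfinish (alpha_word act x0 \<alpha> w) = word_act w x0"
    "cls (reversepath (alpha_word act x0 \<alpha> w)) = cls (reversepath (alpha_path w))"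
proof -
  have h: "homotopic_paths X (alpha_path w) (alpha_word act x0 \<alpha> w)"
    using class_alpha_word[OF assms] alpha_path[OF assms] path_class_eq_iff by metis
  then show "path_in X (alpha_word act x0 \<alpha> w)" "pathstart (alpha_word act x0 \<alpha> w) = x0"
    "pathfinish (alpha_word act x0 \<alpha> w) = word_act w x0"
    using alpha_path[OF assms] homotopic_paths_imp_pathstart homotopic_paths_imp_pathfinish
      path_in_path_class in_path_class by metis+
  show "cls (reversepath (alpha_word act x0 \<alpha> w)) = cls (reversepath (alpha_path w))"
    using h by (intro path_class_eqI[symmetric]) (simp add: homotopic_paths_reversepath)
qed

text \<open>The cocycle rule read backwards. Reversal is available for paths and not for classes, so
  a representative \<open>?p\<close> is reversed.\<close>

lemma class_reversepath_alpha_path_append: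
  assumes "u \<in> words S" "v \<in> words S"
  shows "cls (reversepath (alpha_path (reduce (u @ v)))) =
    u \<bullet>\<^sub>c cls (reversepath (alpha_path v)) \<odot> cls (reversepath (alpha_path u))"
proof -
  note a = alpha_path[OF assms(1)] alpha_path[OF assms(2)]
  let ?p = "alpha_path u +++ (word_act u \<circ> alpha_path v)"
  have e: "pathfinish (alpha_path u) = pathstart (word_act u \<circ> alpha_path v)"
    using a by (simp add: pathstart_compose)
  have p: "path_in X ?p"
    using a assms e by simp
  have "cls ?p = cls (alpha_path (reduce (u @ v)))"
    using a assms
    by (simp add: class_prod_path_class class_act_path_class class_alpha_path_reduce class_alpha_path_append)
  then have "homotopic_paths X (reversepath ?p) (reversepath (alpha_path (reduce (u @ v))))"
    using p by (simp add: path_class_eq_iff homotopic_paths_reversepath)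
  then have "cls (reversepath (alpha_path (reduce (u @ v)))) = cls (reversepath ?p)"
    by (simp add: path_class_eqI)
  also have "reversepath ?p = (word_act u \<circ> reversepath (alpha_path v)) +++ reversepath (alpha_path u)"
    using e by (simp add: reversepath_joinpaths path_compose_reversepath)
  finally show ?thesis
    using a assms by (simp add: class_prod_path_class class_act_path_class)
qed

section \<open>The fundamental group, the action on it and the semidirect product\<close>

abbreviation \<pi> :: "(real \<Rightarrow> 'a) set monoid" where "\<pi> \<equiv> fundamental_group X x0"
abbreviation F :: "'s letter list monoid" where "F \<equiv> free_group S"
abbreviation \<phi> :: "'s letter list \<Rightarrow> (real \<Rightarrow> 'a) set \<Rightarrow> (real \<Rightarrow> 'a) set" where "\<phi> \<equiv> phi act X x0 \<alpha>"
abbreviation J\<Pi> :: "('s, 'a) jpath set monoid" where "J\<Pi> \<equiv> jumping_fundamental_group S act X x0"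
abbreviation jcls :: "('s, 'a) jpath \<Rightarrow> ('s, 'a) jpath set" where "jcls \<equiv> jclass S act X"

lemma loops_at_iff: "p \<in> loops_at X x0 \<longleftrightarrow> path_in X p \<and> pathstart p = x0 \<and> pathfinish p = x0"
  by (auto simp: loops_at_def path_in_def)

lemma pi_carrierE:
  assumes "C \<in> carrier \<pi>"
  obtains p where "C = cls p" "path_in X p" "pathstart p = x0" "pathfinish p = x0"
  using assms by (auto simp: fundamental_group_def loops_at_iff)

lemma pi_carrierI: "path_in X p \<Longrightarrow> pathstart p = x0 \<Longrightarrow> pathfinish p = x0 \<Longrightarrow> cls p \<in> carrier \<pi>"
  by (auto simp: fundamental_group_def loops_at_iff)

lemma pi_one: "\<one>\<^bsub>\<pi>\<^esub> = cls (\<lambda>_. x0)"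
  by (simp add: fundamental_group_def)

lemma pi_mult:
  assumes "C \<in> carrier \<pi>" "D \<in> carrier \<pi>"
  shows "C \<otimes>\<^bsub>\<pi>\<^esub> D = C \<odot> D"
proof -
  have "Collect (path_in X) \<inter> C = C" "Collect (path_in X) \<inter> D = D"
    using assms path_in_path_class by (auto simp: fundamental_group_def)
  then show ?thesis by (simp add: fundamental_group_def class_prod_def)
qed

lemma pi_prod_closed:
  assumes "C \<in> carrier \<pi>" "D \<in> carrier \<pi>"
  shows "C \<odot> D \<in> carrier \<pi>"
  using assms by (elim pi_carrierE) (simp add: pi_carrierI flip: class_prod_path_class)

lemma group_pi: "group \<pi>"
proof (rule groupI)
  show "C \<otimes>\<^bsub>\<pi>\<^esub> D \<in> carrier \<pi>" if "C \<in> carrier \<pi>" "D \<in> carrier \<pi>" for C D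
    using that by (simp add: pi_mult pi_prod_closed)
  show "\<one>\<^bsub>\<pi>\<^esub> \<in> carrier \<pi>"
    by (simp add: pi_one pi_carrierI x0)
  show "C \<otimes>\<^bsub>\<pi>\<^esub> D \<otimes>\<^bsub>\<pi>\<^esub> E = C \<otimes>\<^bsub>\<pi>\<^esub> (D \<otimes>\<^bsub>\<pi>\<^esub> E)"
    if "C \<in> carrier \<pi>" "D \<in> carrier \<pi>" "E \<in> carrier \<pi>" for C D E
    using that by (simp add: pi_mult pi_prod_closed class_prod_assoc)
  fix C assume C: "C \<in> carrier \<pi>"
  then obtain p where p: "C = cls p" "path_in X p" "pathstart p = x0" "pathfinish p = x0"
    by (rule pi_carrierE)
  have one: "cls (\<lambda>_. x0) \<in> carrier \<pi>"
    by (simp add: pi_carrierI x0)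
  show "\<one>\<^bsub>\<pi>\<^esub> \<otimes>\<^bsub>\<pi>\<^esub> C = C"
    using p C one by (simp add: pi_mult pi_one class_prod_const_left)
  have "cls (reversepath p) \<in> carrier \<pi>"
    using p by (simp add: pi_carrierI)
  then show "\<exists>D\<in>carrier \<pi>. D \<otimes>\<^bsub>\<pi>\<^esub> C = \<one>\<^bsub>\<pi>\<^esub>"
    using p C by (intro bexI[of _ "cls (reversepath p)"]) (simp_all add: pi_mult pi_one class_prod_reversepath_left)
qed

text \<open>All members of \<open>C\<close> contribute the same class, so the union in
  \<open>phi\<close> collapses to a conjugation formula in classes.\<close>

lemma phi_eq:
  assumes "w \<in> carrier F" "C \<in> carrier \<pi>"
  shows "\<phi> w C = cls (alpha_path w) \<odot> w \<bullet>\<^sub>c C \<odot> cls (reversepath (alpha_path w))"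
proof -
  obtain p where p: "C = cls p" "path_in X p" "pathstart p = x0" "pathfinish p = x0"
    using assms(2) by (rule pi_carrierE)
  have w: "w \<in> words S" using assms(1) by (simp add: free_group_carrier)
  note a = alpha_word[OF w]
  have "cls (alpha_word act x0 \<alpha> w +++ (act w \<circ> q) +++ reversepath (alpha_word act x0 \<alpha> w)) =
      cls (alpha_path w) \<odot> w \<bullet>\<^sub>c C \<odot> cls (reversepath (alpha_path w))"
    if "q \<in> C" for q
  proof -
    have q: "homotopic_paths X p q" "path_in X q"
      using that path_in_path_class by (auto simp: p(1) in_path_class)
    then have "cls q = C" "pathstart q = x0" "pathfinish q = x0"
      using p homotopic_paths_imp_pathstart homotopic_paths_imp_pathfinish path_class_eqI by metis+
    then show ?thesis
      using a q w assms(1)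
      by (simp add: act_free_group class_prod_path_class class_act_path_class class_alpha_word
          pathstart_compose pathfinish_compose)
  qed
  then have "(\<Union>q\<in>C. cls (alpha_word act x0 \<alpha> w +++ (act w \<circ> q) +++ reversepath (alpha_word act x0 \<alpha> w))) =
      (\<Union>q\<in>C. cls (alpha_path w) \<odot> w \<bullet>\<^sub>c C \<odot> cls (reversepath (alpha_path w)))"
    by (intro SUP_cong refl) blast
  also have "\<dots> = cls (alpha_path w) \<odot> w \<bullet>\<^sub>c C \<odot> cls (reversepath (alpha_path w))"
    using p in_path_class_self[OF p(2)] by auto
  finally show ?thesis
    using assms by (simp add: phi_def)
qed

lemma phi_closed:
  assumes "w \<in> carrier F" "C \<in> carrier \<pi>"
  shows "\<phi> w C \<in> carrier \<pi>"
proof -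
  obtain p where p: "C = cls p" "path_in X p" "pathstart p = x0" "pathfinish p = x0"
    using assms(2) by (rule pi_carrierE)
  have w: "w \<in> words S" using assms(1) by (simp add: free_group_carrier)
  have "\<phi> w C = cls (alpha_path w +++ (word_act w \<circ> p) +++ reversepath (alpha_path w))"
    using alpha_path[OF w] p w phi_eq[OF assms]
    by (simp add: class_prod_path_class class_act_path_class pathstart_compose pathfinish_compose)
  then show ?thesis
    using alpha_path[OF w] p w by (simp add: pi_carrierI pathstart_compose pathfinish_compose)
qed

lemma phi_mult:
  assumes "w \<in> carrier F" "C \<in> carrier \<pi>" "D \<in> carrier \<pi>"
  shows "\<phi> w (C \<otimes>\<^bsub>\<pi>\<^esub> D) = \<phi> w C \<otimes>\<^bsub>\<pi>\<^esub> \<phi> w D"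
proof -
  obtain p where p: "C = cls p" "path_in X p" "pathstart p = x0" "pathfinish p = x0"
    using assms(2) by (rule pi_carrierE)
  obtain q where q: "D = cls q" "path_in X q" "pathstart q = x0" "pathfinish q = x0"
    using assms(3) by (rule pi_carrierE)
  have w: "w \<in> words S" using assms(1) by (simp add: free_group_carrier)
  \<comment> \<open>Cancelling the inner pair of alpha paths leaves a constant class, which
    \<open>class_prod_const_left'\<close> absorbs only into the class of an explicit path.\<close>
  have D: "w \<bullet>\<^sub>c D = cls (word_act w \<circ> q)"
    using q w by (simp add: class_act_path_class)
  have "pathstart (word_act w \<circ> q) = word_act w x0" "path_in X (word_act w \<circ> q)"
    using q w by (simp_all add: pathstart_compose)
  then have "\<phi> w (C \<odot> D) = \<phi> w C \<odot> \<phi> w D"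
    using alpha_path[OF w] w assms
    by (simp add: pi_prod_closed phi_eq class_act_prod class_prod_assoc D
        class_prod_reversepath_left' class_prod_const_left')
  then show ?thesis
    using assms by (simp add: pi_mult phi_closed)
qed

text \<open>Conjugation by the path of a product is conjugation in two stages: the cocycle rule
  splits the path in front, its reversed form the path behind.\<close>

lemma phi_comp:
  assumes "u \<in> carrier F" "v \<in> carrier F" "C \<in> carrier \<pi>"
  shows "\<phi> (u \<otimes>\<^bsub>F\<^esub> v) C = \<phi> u (\<phi> v C)"
proof -
  have w: "u \<in> words S" "v \<in> words S"
    using assms by (simp_all add: free_group_carrier)
  have "reduce (u @ v) \<in> carrier F"
    using w by (simp add: reduce_in_free_group)
  moreover have "reduce (u @ v) \<bullet>\<^sub>c C = (u @ v) \<bullet>\<^sub>c C"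
    by (rule class_act_cong) simp
  ultimately have "\<phi> (reduce (u @ v)) C = (cls (alpha_path u) \<odot> u \<bullet>\<^sub>c cls (alpha_path v)) \<odot> (u @ v) \<bullet>\<^sub>c C \<odot>
      u \<bullet>\<^sub>c cls (reversepath (alpha_path v)) \<odot> cls (reversepath (alpha_path u))"
    using w assms
    by (simp add: phi_eq class_alpha_path_reduce class_alpha_path_append
        class_reversepath_alpha_path_append)
  also have "\<dots> = cls (alpha_path u) \<odot> u \<bullet>\<^sub>c \<phi> v C \<odot> cls (reversepath (alpha_path u))"
    using w assms by (simp add: phi_eq class_act_prod class_act_act class_prod_assoc)
  also have "\<dots> = \<phi> u (\<phi> v C)"
    using assms by (simp only: phi_eq[OF _ phi_closed])
  finally show ?thesis by (simp add: free_group_def)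
qed

lemma phi_one: "C \<in> carrier \<pi> \<Longrightarrow> \<phi> \<one>\<^bsub>F\<^esub> C = C"
proof (elim pi_carrierE)
  fix p assume p: "C = cls p" "path_in X p" "pathstart p = x0" "pathfinish p = x0"
  then have C: "C \<in> carrier \<pi>" by (simp add: pi_carrierI)
  have "[] \<in> carrier F" by (simp add: free_group_carrier reduced_def)
  moreover have "reversepath (\<lambda>_. x0) = (\<lambda>_. x0)"
    by (simp add: reversepath_def)
  ultimately show ?thesis
    using phi_eq[OF _ C, of "[]"] p
    by (simp add: free_group_def class_prod_const_left class_prod_const_right)
qed

lemma phi_auto:
  assumes w: "w \<in> carrier F"
  shows "\<phi> w \<in> auto \<pi>"
proof -
  interpret F: group F by (rule group_free_group)
  have "bij_betw (\<phi> w) (carrier \<pi>) (carrier \<pi>)"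
  proof (rule bij_betwI[where g = "\<phi> (inv\<^bsub>F\<^esub> w)"])
    show "\<phi> w \<in> carrier \<pi> \<rightarrow> carrier \<pi>" "\<phi> (inv\<^bsub>F\<^esub> w) \<in> carrier \<pi> \<rightarrow> carrier \<pi>"
      using w by (auto simp: phi_closed)
    show "\<phi> (inv\<^bsub>F\<^esub> w) (\<phi> w C) = C" "\<phi> w (\<phi> (inv\<^bsub>F\<^esub> w) C) = C" if "C \<in> carrier \<pi>" for C
      using that w by (simp_all add: phi_one flip: phi_comp)
  qed
  then show ?thesis
    \<comment> \<open>Automorphisms must be extensional on the carrier; the restriction in the
      definition of \<open>phi\<close> provides this.\<close>
    using w by (auto simp: auto_def hom_def Bij_def phi_closed phi_mult) (auto simp: phi_def)
qed

lemma group_hom_phi: "group_hom F (AutoGroup \<pi>) \<phi>"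
proof -
  have "\<phi> (u \<otimes>\<^bsub>F\<^esub> v) = compose (carrier \<pi>) (\<phi> u) (\<phi> v)" if "u \<in> carrier F" "v \<in> carrier F" for u v
    using phi_comp[OF that] by (auto simp: compose_def phi_def fun_eq_iff)
  then have "\<phi> \<in> hom F (AutoGroup \<pi>)"
    using phi_auto by (auto simp: hom_def AutoGroup_def BijGroup_def auto_def)
  then show ?thesis
    by (simp add: group_hom_def group_hom_axioms_def group_free_group group.AutoGroup[OF group_pi])
qed

lemma group_semidirect: "group (semidirect_prod \<pi> F \<phi>)"
proof -
  interpret F: group F by (rule group_free_group)
  interpret \<pi>: group \<pi> by (rule group_pi)
  show ?thesis
  proof (rule groupI)
    fix x assume "x \<in> carrier (semidirect_prod \<pi> F \<phi>)"
    then obtain C w where x: "x = (C, w)" "C \<in> carrier \<pi>" "w \<in> carrier F"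
      by (auto simp: semidirect_prod_def)
    show "\<exists>y\<in>carrier (semidirect_prod \<pi> F \<phi>). y \<otimes>\<^bsub>semidirect_prod \<pi> F \<phi>\<^esub> x = \<one>\<^bsub>semidirect_prod \<pi> F \<phi>\<^esub>"
      \<comment> \<open>In the product on the left, \<open>C\<close> is first acted on by the
        inverse of \<open>w\<close>; the first entry has to cancel the result.\<close>
      using x by (intro bexI[of _ "(inv\<^bsub>\<pi>\<^esub> (\<phi> (inv\<^bsub>F\<^esub> w) C), inv\<^bsub>F\<^esub> w)"])
        (auto simp: semidirect_prod_def phi_closed)
  qed (auto simp: semidirect_prod_def phi_closed phi_mult phi_comp phi_one \<pi>.m_assoc F.m_assoc)
qed

section \<open>Representatives, and products of classes of jumping-paths\<close>

text \<open>The first piece ends at the translate of \<open>x0\<close> by \<open>w\<close>, and each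
  jump strips the first letter of what is left of \<open>w\<close>. The representatives are thus
  normal forms, whose invariants are known.\<close>

lemma Phi_rep_eq_normal_jpath:
  assumes "w \<in> words S" "path_in X p"
  shows "Phi_rep act x0 \<alpha> p w = normal_jpath (p +++ alpha_word act x0 \<alpha> w) (map inv_letter w)"
proof -
  have "map (\<lambda>i (_::real). word_act (drop i w) x0) [1..<Suc (length w)] =
      jump_trace (word_act w x0) (map inv_letter w)"
    using assms(1)
  proof (induction w)
    case (Cons l w)
    \<comment> \<open>The range starts at 1 because piece 0 is the moving one; the shift matches the
      recursion of \<open>jump_trace\<close>.\<close>
    have "[1..<Suc (length (l # w))] = 1 # map Suc [1..<Suc (length w)]"
      by (simp add: upt_conv_Cons map_Suc_upt del: upt_Suc)
    moreover have "word_act [inv_letter l] (word_act (l # w) x0) = word_act w x0"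
      using Cons.prems x0 word_act_Cons[of l w x0] by (simp add: word_act_in)
    ultimately show ?case
      using Cons by (simp add: o_def del: upt_Suc)
  qed simp
  then show ?thesis
    by (simp add: Phi_rep_def normal_jpath_def alpha_word[OF assms(1)] flip: word_act_def)
qed

lemma Phi_rep:
  assumes "w \<in> words S" "path_in X p" "pathstart p = x0" "pathfinish p = x0"
  shows "jpath (Phi_rep act x0 \<alpha> p w)" "jstart (Phi_rep act x0 \<alpha> p w) = x0"
    "jfinish (Phi_rep act x0 \<alpha> p w) = x0"
    "cls (unfold (Phi_rep act x0 \<alpha> p w)) = cls p \<odot> cls (alpha_path w)"
    "snd (Phi_rep act x0 \<alpha> p w) = map inv_letter w"
proof -
  note a = alpha_word[OF assms(1)]
  let ?J = "Phi_rep act x0 \<alpha> p w" and ?q = "p +++ alpha_word act x0 \<alpha> w"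
  have q: "path_in X ?q"
    using a assms by simp
  have n: "jpath (normal_jpath ?q (map inv_letter w)) \<and> cls (unfold (normal_jpath ?q (map inv_letter w))) = cls ?q"
    using assms by (intro jpath_normal_jpath q) simp
  then show J: "jpath ?J" and U: "cls (unfold ?J) = cls p \<odot> cls (alpha_path w)"
    using a assms by (simp_all add: Phi_rep_eq_normal_jpath class_prod_path_class class_alpha_word)
  show "jstart ?J = x0" and s: "snd ?J = map inv_letter w"
    using assms by (simp_all add: Phi_rep_def jstart_def)
  \<comment> \<open>The final point is read off the unfolding: translated by \<open>w\<close> it
    equals the translate of \<open>x0\<close>, and the action is injective.\<close>
  have "homotopic_paths X (unfold ?J) ?q"
    using n unfold_ends(1)[OF J] assms by (simp add: Phi_rep_eq_normal_jpath path_class_eq_iff)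
  then have "word_act w (jfinish ?J) = word_act w x0"
    using unfold_ends(3)[OF J] a(3) by (simp add: s homotopic_paths_imp_pathfinish)
  then show "jfinish ?J = x0"
    using word_act_eq_iff[OF assms(1) jfinish_in[OF J] x0] by simp
qed

text \<open>Independence of the representatives is checked on the invariants of the concatenation,
  without concatenating any homotopies.\<close>

lemma jclass_mult:
  assumes "jpath J" "jpath K" "jfinish J = jstart K"
  shows "jcls J \<otimes>\<^bsub>J\<Pi>\<^esub> jcls K = jcls (jconcat J K)"
proof -
  have "jcls (jconcat J' K') = jcls (jconcat J K)"
    if J': "jhomotopic S act X J J'" and K': "jhomotopic S act X K K'" for J' K'
  proof -
    note j = jhomotopic_imp[OF J' assms(1)] jhomotopic_imp[OF K' assms(2)]
    have "jfinish J' = jstart K'"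
      using j assms(3) by simp
    moreover have "map inv_letter (snd J') \<bullet>\<^sub>c C = map inv_letter (snd J) \<bullet>\<^sub>c C" for C
      using j by (intro class_act_cong) (simp add: reduce_map_inv_letter)
    ultimately show ?thesis
      using jpath_jconcat[OF assms] jpath_jconcat[of J' K'] j
      by (subst jclass_eq_iff) (auto intro!: reduce_append_cong)
  qed
  then have "jcls J \<otimes>\<^bsub>J\<Pi>\<^esub> jcls K = (\<Union>J'\<in>jcls J. \<Union>K'\<in>jcls K. jcls (jconcat J K))"
    unfolding jumping_fundamental_group_def by (auto simp: jclass_def[of _ _ _ J] jclass_def[of _ _ _ K])
  also have "\<dots> = jcls (jconcat J K)"
  proof -
    have "J \<in> jcls J" "K \<in> jcls K"
      by (simp_all add: jclass_def jhomotopic_refl)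
    then show ?thesis by blast
  qed
  finally show ?thesis .
qed

section \<open>The map, its multiplicativity and its bijectivity\<close>

definition Phi :: "(real \<Rightarrow> 'a) set \<times> 's letter list \<Rightarrow> ('s, 'a) jpath set" where
  "Phi = (\<lambda>(C, w). \<Union>p\<in>C. jcls (Phi_rep act x0 \<alpha> p w))"

text \<open>The invariants of \<open>Phi_rep\<close> see the loop only through its class and the
  word only through its reduction. So the union in \<open>Phi\<close> runs over equal sets, and
  unreduced words are allowed.\<close>

lemma Phi_path_class:
  assumes "w \<in> words S" "p \<in> loops_at X x0"
  shows "Phi (cls p, reduce w) = jcls (Phi_rep act x0 \<alpha> p w)"
proof -
  have p: "path_in X p" "pathstart p = x0" "pathfinish p = x0"
    using assms(2) by (simp_all add: loops_at_iff)
  have "jcls (Phi_rep act x0 \<alpha> q (reduce w)) = jcls (Phi_rep act x0 \<alpha> p w)" if "q \<in> cls p" for q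
  proof -
    have q: "homotopic_paths X p q" "path_in X q"
      using that path_in_path_class by (auto simp: in_path_class)
    then have q': "cls q = cls p" "pathstart q = x0" "pathfinish q = x0"
      using p homotopic_paths_imp_pathstart homotopic_paths_imp_pathfinish path_class_eqI by metis+
    show ?thesis
      using Phi_rep[OF reduce_words[OF assms(1)] q(2) q'(2,3)] Phi_rep[OF assms(1) p] q' assms(1)
      by (subst jclass_eq_iff) (simp_all add: class_alpha_path_reduce reduce_map_inv_letter)
  qed
  then have "Phi (cls p, reduce w) = (\<Union>q\<in>cls p. jcls (Phi_rep act x0 \<alpha> p w))"
    by (simp add: Phi_def)
  then show ?thesis
    using in_path_class_self[OF p(1)] by auto
qed

lemma Phi_cls:
  assumes "w \<in> carrier F" "path_in X p" "pathstart p = x0" "pathfinish p = x0"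
  shows "Phi (cls p, w) = jcls (Phi_rep act x0 \<alpha> p w)"
  using Phi_path_class[of w p] assms by (simp add: free_group_carrier loops_at_iff reduce_reduced)

lemma Phi_hom: "Phi \<in> hom (semidirect_prod \<pi> F \<phi>) J\<Pi>"
proof (rule homI)
  fix x assume "x \<in> carrier (semidirect_prod \<pi> F \<phi>)"
  then obtain C u where x: "x = (C, u)" "C \<in> carrier \<pi>" "u \<in> carrier F"
    by (auto simp: semidirect_prod_def)
  obtain p where p: "C = cls p" "path_in X p" "pathstart p = x0" "pathfinish p = x0"
    using x(2) by (rule pi_carrierE)
  have u: "u \<in> words S" using x(3) by (simp add: free_group_carrier)
  note R = Phi_rep[OF u p(2-4)]
  have Px: "Phi x = jcls (Phi_rep act x0 \<alpha> p u)"
    using x p by (simp add: Phi_cls)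
  show "Phi x \<in> carrier J\<Pi>"
    using R by (auto simp: Px jumping_fundamental_group_def jloops_at_def)
  fix y assume "y \<in> carrier (semidirect_prod \<pi> F \<phi>)"
  then obtain D v where y: "y = (D, v)" "D \<in> carrier \<pi>" "v \<in> carrier F"
    by (auto simp: semidirect_prod_def)
  obtain q where q: "D = cls q" "path_in X q" "pathstart q = x0" "pathfinish q = x0"
    using y(2) by (rule pi_carrierE)
  have v: "v \<in> words S" using y(3) by (simp add: free_group_carrier)
  note Q = Phi_rep[OF v q(2-4)]
  have Py: "Phi y = jcls (Phi_rep act x0 \<alpha> q v)"
    using y q by (simp add: Phi_cls)
  have "C \<otimes>\<^bsub>\<pi>\<^esub> \<phi> u D \<in> carrier \<pi>"
    using x y by (simp add: pi_mult pi_prod_closed phi_closed)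
  \<comment> \<open>\<open>Phi_rep\<close> takes a loop and not a class, so the first coordinate of
    the product is given a representative.\<close>
  then obtain r where r: "C \<otimes>\<^bsub>\<pi>\<^esub> \<phi> u D = cls r" "path_in X r" "pathstart r = x0" "pathfinish r = x0"
    by (rule pi_carrierE)
  have cr: "cls r = cls p \<odot> cls (alpha_path u) \<odot> u \<bullet>\<^sub>c cls q \<odot> cls (reversepath (alpha_path u))"
    unfolding p(1)[symmetric] q(1)[symmetric]
    using r(1) pi_mult[OF x(2) phi_closed[OF x(3) y(2)]] phi_eq[OF x(3) y(2)] by metis
  have uv: "u @ v \<in> words S" using u v by simp
  note W = Phi_rep[OF reduce_words[OF uv] r(2-4)]
  have "Phi (x \<otimes>\<^bsub>semidirect_prod \<pi> F \<phi>\<^esub> y) = Phi (cls r, reduce (u @ v))"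
    by (simp add: x(1) y(1) semidirect_prod_def r(1) free_group_def)
  also have "\<dots> = jcls (Phi_rep act x0 \<alpha> r (reduce (u @ v)))"
    using r uv by (simp add: Phi_cls reduce_in_free_group)
  also have "\<dots> = jcls (jconcat (Phi_rep act x0 \<alpha> p u) (Phi_rep act x0 \<alpha> q v))"
  proof (subst jclass_eq_iff)
    have e: "jfinish (Phi_rep act x0 \<alpha> p u) = jstart (Phi_rep act x0 \<alpha> q v)"
      using R Q by simp
    note c = jpath_jconcat[OF R(1) Q(1) e]
    show "jpath (Phi_rep act x0 \<alpha> r (reduce (u @ v)))" by (rule W)
    show "jpath (jconcat (Phi_rep act x0 \<alpha> p u) (Phi_rep act x0 \<alpha> q v))"
      using c by blast
    have U: "path_in X (word_act u \<circ> alpha_path v)" "pathstart (word_act u \<circ> alpha_path v) = word_act u x0"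
      using alpha_path[OF v] u by (simp_all add: pathstart_compose)
    \<comment> \<open>The reversed path of \<open>u\<close> at the end of \<open>cls r\<close>
      cancels the path of \<open>u\<close> with which that of \<open>u @ v\<close> begins. What
      remains is the unfolding of the concatenation.\<close>
    have "cls r \<odot> cls (alpha_path (reduce (u @ v))) =
        cls p \<odot> cls (alpha_path u) \<odot> u \<bullet>\<^sub>c cls q \<odot> u \<bullet>\<^sub>c cls (alpha_path v)"
      using u v alpha_path[OF u] alpha_path[OF v] U
      by (simp add: cr class_alpha_path_reduce class_alpha_path_append class_prod_assoc
          class_prod_reversepath_left' class_prod_const_left flip: class_act_path_class)
    moreover have "reduce (map inv_letter (reduce (u @ v))) = reduce (map inv_letter u @ map inv_letter v)"
      by (simp add: reduce_map_inv_letter flip: map_append)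
    ultimately show "cls (unfold (Phi_rep act x0 \<alpha> r (reduce (u @ v)))) =
        cls (unfold (jconcat (Phi_rep act x0 \<alpha> p u) (Phi_rep act x0 \<alpha> q v))) \<and>
        reduce (snd (Phi_rep act x0 \<alpha> r (reduce (u @ v)))) =
        reduce (snd (jconcat (Phi_rep act x0 \<alpha> p u) (Phi_rep act x0 \<alpha> q v)))"
      using c W R Q u by (simp add: class_act_prod class_prod_assoc)
  qed
  also have "\<dots> = Phi x \<otimes>\<^bsub>J\<Pi>\<^esub> Phi y"
    using R Q by (simp add: Px Py jclass_mult)
  finally show "Phi (x \<otimes>\<^bsub>semidirect_prod \<pi> F \<phi>\<^esub> y) = Phi x \<otimes>\<^bsub>J\<Pi>\<^esub> Phi y" .
qed

lemma inj_on_Phi: "inj_on Phi (carrier (semidirect_prod \<pi> F \<phi>))"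
proof (rule inj_onI)
  fix x y assume "x \<in> carrier (semidirect_prod \<pi> F \<phi>)" "y \<in> carrier (semidirect_prod \<pi> F \<phi>)"
    and eq: "Phi x = Phi y"
  then obtain C u D v where x: "x = (C, u)" "C \<in> carrier \<pi>" "u \<in> carrier F"
    and y: "y = (D, v)" "D \<in> carrier \<pi>" "v \<in> carrier F"
    by (auto simp: semidirect_prod_def)
  obtain p where p: "C = cls p" "path_in X p" "pathstart p = x0" "pathfinish p = x0"
    using x(2) by (rule pi_carrierE)
  obtain q where q: "D = cls q" "path_in X q" "pathstart q = x0" "pathfinish q = x0"
    using y(2) by (rule pi_carrierE)
  have w: "u \<in> words S" "v \<in> words S" and red: "Defs.reduced u" "Defs.reduced v"
    using x(3) y(3) by (simp_all add: free_group_carrier)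
  note R = Phi_rep[OF w(1) p(2-4)] and Q = Phi_rep[OF w(2) q(2-4)]
  have "jcls (Phi_rep act x0 \<alpha> p u) = jcls (Phi_rep act x0 \<alpha> q v)"
    using eq x y p q by (simp add: Phi_cls)
  then have *: "cls p \<odot> cls (alpha_path u) = cls q \<odot> cls (alpha_path v)"
      "reduce (map inv_letter u) = reduce (map inv_letter v)"
    using R Q by (simp_all add: jclass_eq_iff)
  \<comment> \<open>The words are reduced, hence so are their letterwise inverses, and the patterns
    themselves agree.\<close>
  then have "map inv_letter (map inv_letter u) = map inv_letter (map inv_letter v)"
    using red by (simp only: reduce_map_inv_letter reduce_reduced)
  then have uv: "u = v" by simp
  have "cls p = (cls p \<odot> cls (alpha_path u)) \<odot> cls (reversepath (alpha_path u))"
    using alpha_path[OF w(1)] p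
    by (simp add: class_prod_assoc class_prod_reversepath_right class_prod_const_right)
  also have "\<dots> = cls q"
    using alpha_path[OF w(1)] q
    by (simp add: *(1) flip: uv) (simp add: class_prod_assoc class_prod_reversepath_right class_prod_const_right)
  finally show "x = y"
    by (simp add: x(1) y(1) p(1) q(1) uv)
qed

lemma Phi_surj: "carrier J\<Pi> \<subseteq> Phi ` carrier (semidirect_prod \<pi> F \<phi>)"
proof
  fix Z assume "Z \<in> carrier J\<Pi>"
  then obtain J where J: "Z = jcls J" "jpath J" "jstart J = x0" "jfinish J = x0"
    by (auto simp: jumping_fundamental_group_def jloops_at_def)
  \<comment> \<open>Both witnesses are forced by \<open>Phi_rep\<close>: its pattern inverts
    \<open>w\<close> letter by letter, and its unfolding is the loop followed by the path of
    \<open>w\<close>.\<close>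
  define w where "w = reduce (map inv_letter (snd J))"
  have w: "w \<in> carrier F" "w \<in> words S"
    using jpath_words[OF J(2)] by (simp_all add: w_def reduce_in_free_group reduce_words)
  note a = alpha_path[OF w(2)]
  have U: "path_in X (unfold J)" "pathstart (unfold J) = x0" "pathfinish (unfold J) = word_act w x0"
    using unfold_ends[OF J(2)] J by (simp_all add: w_def)
  define p where "p = unfold J +++ reversepath (alpha_path w)"
  have p: "path_in X p" "pathstart p = x0" "pathfinish p = x0"
    using U a by (simp_all add: p_def)
  note R = Phi_rep[OF w(2) p]
  have "cls p \<odot> cls (alpha_path w) = cls (unfold J)"
    using a U by (simp add: p_def class_prod_path_class class_prod_assoc class_prod_reversepath_left
        class_prod_const_right)
  then have "Phi (cls p, w) = Z"
    using R J w p by (simp add: Phi_cls jclass_eq_iff) (simp add: w_def reduce_map_inv_letter)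
  moreover have "(cls p, w) \<in> carrier (semidirect_prod \<pi> F \<phi>)"
    using w p by (simp add: semidirect_prod_def pi_carrierI)
  ultimately show "Z \<in> Phi ` carrier (semidirect_prod \<pi> F \<phi>)"
    by blast
qed

lemma Phi_iso: "Phi \<in> iso (semidirect_prod \<pi> F \<phi>) J\<Pi>"
proof -
  have "Phi ` carrier (semidirect_prod \<pi> F \<phi>) \<subseteq> carrier J\<Pi>"
    using Phi_hom by (auto simp: hom_def)
  then show ?thesis
    using Phi_hom inj_on_Phi Phi_surj by (auto simp: iso_def bij_betw_def)
qed

text \<open>The group laws are transported along the bijective homomorphism. This gives a group
  whose unit is the image of the unit, so only the two units remain to be compared.\<close>

lemma group_jumping: "group J\<Pi>"
proof -
  have "[] \<in> carrier F" "path_in X (\<lambda>_. x0)"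
    by (simp_all add: free_group_carrier reduced_def x0)
  note R = Phi_rep[of "[]" "\<lambda>_. x0", OF _ this(2)]
  have "Phi \<one>\<^bsub>semidirect_prod \<pi> F \<phi>\<^esub> = jcls (Phi_rep act x0 \<alpha> (\<lambda>_. x0) [])"
    using Phi_cls[of "[]" "\<lambda>_. x0"] \<open>[] \<in> carrier F\<close> x0
    by (simp add: semidirect_prod_def pi_one) (simp add: free_group_def)
  also have "\<dots> = \<one>\<^bsub>J\<Pi>\<^esub>"
    using R x0 unfolding jumping_fundamental_group_def
    by (simp add: jclass_eq_iff jpath_Nil class_prod_const_left)
  finally have "J\<Pi> \<lparr>one := Phi \<one>\<^bsub>semidirect_prod \<pi> F \<phi>\<^esub>\<rparr> = J\<Pi>"
    by simp
  then show ?thesis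
    using group.iso_imp_img_group[OF group_semidirect Phi_iso] by simp
qed

end

theorem theorem4p9:
  fixes X :: "'a::metric_space set" and x0 :: 'a and S :: "'s set"
    and act :: "'s letter list \<Rightarrow> 'a \<Rightarrow> 'a" and \<alpha> :: "'s \<Rightarrow> real \<Rightarrow> 'a"
  assumes "path_connected X" and "locally path_connected X" and "x0 \<in> X"
    and "finite S"
    and "group_action (free_group S) X act"
    and "\<And>w. w \<in> carrier (free_group S) \<Longrightarrow> \<exists>g. homeomorphism X X (act w) g"
    and "\<And>s. s \<in> S \<Longrightarrow> path (\<alpha> s) \<and> path_image (\<alpha> s) \<subseteq> X \<and>
           pathstart (\<alpha> s) = x0 \<and> pathfinish (\<alpha> s) = act [(s, True)] x0"
  defines "\<pi> \<equiv> fundamental_group X x0"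
    and "F \<equiv> free_group S"
    and "\<phi> \<equiv> phi act X x0 \<alpha>"
    and "J\<Pi> \<equiv> jumping_fundamental_group S act X x0"
  shows "group \<pi> \<and> group_hom F (AutoGroup \<pi>) \<phi> \<and>
    group (semidirect_prod \<pi> F \<phi>) \<and> group J\<Pi> \<and>
    (\<exists>\<Phi> \<in> iso (semidirect_prod \<pi> F \<phi>) J\<Pi>.
      \<forall>p \<in> loops_at X x0. \<forall>w \<in> words S.
        \<Phi> (path_class X p, reduce w) = jclass S act X (Phi_rep act x0 \<alpha> p w))"
proof -
  interpret A: based_free_action S X act x0 \<alpha>
  proof (intro based_free_action.intro free_action.intro based_free_action_axioms.intro)
    show "continuous_on X (act w)" if "w \<in> carrier (free_group S)" for w
      using assms(6)[OF that] homeomorphism_cont1 by blast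
  qed (use assms(3,5,7) in auto)
  show ?thesis
    unfolding \<pi>_def F_def \<phi>_def J\<Pi>_def
    using A.group_pi A.group_hom_phi A.group_semidirect A.group_jumping A.Phi_iso A.Phi_path_class
    by blast
qed

end
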